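(* Let $\Omega\subset\mathbb{C}^d$ be a bounded open set which is locally convexifiable and has finite local line type $L$, and let $\{(V_\xi,\Phi_\xi):\xi\in\partial\Omega\}$ be a good locally convex atlas. Then there exist $K,\delta>0$ such that for every $\xi\in\partial\Omega$ and all $p,q\in B_\delta(\xi)\cap\Omega$, $$d_\Omega(p,q)\le d_{\Omega\cap V_\xi}(p,q)\le d_\Omega(p,q)+K.$$
   Context: $d_\Omega$ is the Kobayashi distance. $\delta_\Omega(p)$ is the Euclidean distance to $\mathbb{C}^d\setminus\Omega$, and $\delta_\Omega(p;v)=\inf\{\|q-p\|:q\in(p+\mathbb{C}v)\setminus\Omega\}$. A local convex chart at $\xi\in\partial\Omega$ is a pair $(V_\xi,\Phi_\xi)$ with $V_\xi$ a neighborhood of $\xi$ and $\Phi_\xi:V_\xi\to\mathbb{C}^d$ a biholomorphism onto its image with $\Omega_\xi:=\Phi_\xi(V_\xi\cap\Omega)$ convex; a locally convex atlas is a choice of one for each $\xi\in\partial\Omega$. $\Omega$ has finite local line type $L$ if $\partial\Omega$ is a $C^L$ hypersurface and there is a locally convex atlas such that each $\Phi_\xi(\partial\Omega\cap V_\xi)$ has line type at most $L$ near $\Phi_\xi(\xi)$, with equality attained for some $\xi$ (line type at $x$ of $\{r=0\}$: supremum over non-trivial complex affine $\ell:\mathbb{C}\to\mathbb{C}^d$, $\ell(0)=x$, of the order of vanishing of $r\circ\ell$ at $0$). The atlas is good if there are $C,\tau>0$ such that for every $\xi$: $B_\tau(\xi)\subset V_\xi$; $\delta_{\Omega_\xi}(p;v)\le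 C\delta_{\Omega_\xi}(p)^{1/L}$ for all $p\in\Omega_\xi$, $v\neq0$; and $C^{-1}\|p-q\|\le\|\Phi_\xi(p)-\Phi_\xi(q)\|\le C\|p-q\|$ for $p,q\in V_\xi$. *)

theory Defs
  imports "HOL-Analysis.Analysis" "HOL-Complex_Analysis.Complex_Analysis"
begin

definition cholo_on :: "(complex^'n \<Rightarrow> complex^'m) \<Rightarrow> (complex^'n) set \<Rightarrow> bool" where
  "cholo_on f S \<longleftrightarrow>
     (\<forall>x\<in>S. \<exists>D. (f has_derivative D) (at x) \<and> (\<forall>c v. D (c *s v) = c *s D v))"

definition holo_disc :: "(complex \<Rightarrow> complex^'n) \<Rightarrow> bool" where
  "holo_disc f \<longleftrightarrow> (\<forall>i. (\<lambda>z. f z $ i) holomorphic_on ball 0 1)"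

definition poincare_dist :: "complex \<Rightarrow> complex \<Rightarrow> real" where
  "poincare_dist a b = artanh (cmod ((a - b) / (1 - cnj a * b)))"

definition kobayashi_dist :: "(complex^'n) set \<Rightarrow> complex^'n \<Rightarrow> complex^'n \<Rightarrow> ereal" where
  "kobayashi_dist \<Omega> p q = Inf {ereal (\<Sum>j<n. poincare_dist (a j) (b j)) | n f a b.
      0 < n \<and>
      (\<forall>j<n. holo_disc (f j) \<and> f j ` ball 0 1 \<subseteq> \<Omega> \<and> a j \<in> ball 0 1 \<and> b j \<in> ball 0 1) \<and>
      f 0 (a 0) = p \<and> f (n - 1) (b (n - 1)) = q \<and>
      (\<forall>j. Suc j < n \<longrightarrow> f j (b j) = f (Suc j) (a (Suc j)))}"

definition bdist :: "(complex^'n) set \<Rightarrow> complex^'n \<Rightarrow> real" where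
  "bdist \<Omega> p = infdist p (UNIV - \<Omega>)"

definition bdist_dir :: "(complex^'n) set \<Rightarrow> complex^'n \<Rightarrow> complex^'n \<Rightarrow> real" where
  "bdist_dir \<Omega> p v = infdist p (range (\<lambda>z::complex. p + z *s v) - \<Omega>)"

definition local_convex_chart ::
  "(complex^'n) set \<Rightarrow> complex^'n \<Rightarrow> (complex^'n) set \<Rightarrow> (complex^'n \<Rightarrow> complex^'n) \<Rightarrow> bool" where
  "local_convex_chart \<Omega> \<xi> V \<Phi> \<longleftrightarrow>
     open V \<and> \<xi> \<in> V \<and> cholo_on \<Phi> V \<and> inj_on \<Phi> V \<and> open (\<Phi> ` V) \<and>
     (\<exists>\<Psi>. cholo_on \<Psi> (\<Phi> ` V) \<and> (\<forall>x\<in>V. \<Psi> (\<Phi> x) = x)) \<and>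
     convex (\<Phi> ` (V \<inter> \<Omega>))"

definition locally_convex_atlas ::
  "(complex^'n) set \<Rightarrow> (complex^'n \<Rightarrow> (complex^'n) set) \<Rightarrow> (complex^'n \<Rightarrow> complex^'n \<Rightarrow> complex^'n) \<Rightarrow> bool" where
  "locally_convex_atlas \<Omega> V \<Phi> \<longleftrightarrow> (\<forall>\<xi>\<in>frontier \<Omega>. local_convex_chart \<Omega> \<xi> (V \<xi>) (\<Phi> \<xi>))"

definition locally_convexifiable :: "(complex^'n) set \<Rightarrow> bool" where
  "locally_convexifiable \<Omega> \<longleftrightarrow> (\<exists>V \<Phi>. locally_convex_atlas \<Omega> V \<Phi>)"

text \<open>C^k on an open set: all iterated directional derivatives of order at most k exist
  and are continuous on S. D vs is the iterated directional derivative along the list vs.\<close>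
definition Ck_on :: "nat \<Rightarrow> 'a::real_normed_vector set \<Rightarrow> ('a \<Rightarrow> real) \<Rightarrow> bool" where
  "Ck_on k S f \<longleftrightarrow> (\<exists>D :: 'a list \<Rightarrow> 'a \<Rightarrow> real. D [] = f \<and>
      (\<forall>vs. length vs \<le> k \<longrightarrow> continuous_on S (D vs)) \<and>
      (\<forall>vs v x. length vs < k \<longrightarrow> x \<in> S \<longrightarrow>
          ((\<lambda>t. D vs (x + t *\<^sub>R v)) has_real_derivative D (v # vs) x) (at 0)))"

definition local_defining_fn ::
  "nat \<Rightarrow> (complex^'n) set \<Rightarrow> complex^'n \<Rightarrow> (complex^'n \<Rightarrow> real) \<Rightarrow> (complex^'n) set \<Rightarrow> bool" where
  "local_defining_fn k M y r U \<longleftrightarrow>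
     open U \<and> y \<in> U \<and> Ck_on k U r \<and>
     (\<forall>z\<in>U. \<exists>D. (r has_derivative D) (at z) \<and> D \<noteq> (\<lambda>_. 0)) \<and>
     M \<inter> U = {z\<in>U. r z = 0}"

definition Ck_hypersurface :: "nat \<Rightarrow> (complex^'n) set \<Rightarrow> bool" where
  "Ck_hypersurface k M \<longleftrightarrow> (\<forall>y\<in>M. \<exists>r U. local_defining_fn k M y r U)"

text \<open>g vanishes to order at least k at 0: g(t) = o(|t|^(k-1)) as t tends to 0
  (for a C^L function and k \<le> L+1 this is equivalent, by Taylor's formula with Peano
  remainder, to the vanishing of all derivatives of order < k at 0).\<close>
definition vanishes_to_order :: "(complex \<Rightarrow> real) \<Rightarrow> nat \<Rightarrow> bool" where
  "vanishes_to_order g k \<longleftrightarrow> k = 0 \<or>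
     (\<forall>e>0. eventually (\<lambda>t. \<bar>g t\<bar> \<le> e * cmod t ^ (k - 1)) (at 0))"

definition vanishing_order :: "(complex \<Rightarrow> real) \<Rightarrow> enat" where
  "vanishing_order g = Sup {enat k | k. vanishes_to_order g k}"

definition line_type :: "(complex^'n \<Rightarrow> real) \<Rightarrow> complex^'n \<Rightarrow> enat" where
  "line_type r x = (SUP v\<in>{v. v \<noteq> 0}. vanishing_order (\<lambda>t. r (x + t *s v)))"

definition finite_local_line_type :: "(complex^'n) set \<Rightarrow> nat \<Rightarrow> bool" where
  "finite_local_line_type \<Omega> L \<longleftrightarrow>
     Ck_hypersurface L (frontier \<Omega>) \<and>
     (\<exists>V \<Phi>. locally_convex_atlas \<Omega> V \<Phi> \<and>
        (\<forall>\<xi>\<in>frontier \<Omega>. \<exists>W. open W \<and> \<Phi> \<xi> \<xi> \<in> W \<and>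
           (\<forall>y\<in>\<Phi> \<xi> ` (frontier \<Omega> \<inter> V \<xi>) \<inter> W.
              \<exists>r U. local_defining_fn L (\<Phi> \<xi> ` (frontier \<Omega> \<inter> V \<xi>)) y r U \<and>
                    line_type r y \<le> enat L)) \<and>
        (\<exists>\<xi>\<in>frontier \<Omega>. \<exists>y\<in>\<Phi> \<xi> ` (frontier \<Omega> \<inter> V \<xi>).
              \<exists>r U. local_defining_fn L (\<Phi> \<xi> ` (frontier \<Omega> \<inter> V \<xi>)) y r U \<and>
                    line_type r y = enat L))"

definition good_atlas ::
  "(complex^'n) set \<Rightarrow> nat \<Rightarrow> (complex^'n \<Rightarrow> (complex^'n) set) \<Rightarrow> (complex^'n \<Rightarrow> complex^'n \<Rightarrow> complex^'n) \<Rightarrow> bool" where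
  "good_atlas \<Omega> L V \<Phi> \<longleftrightarrow> locally_convex_atlas \<Omega> V \<Phi> \<and>
     (\<exists>C \<tau>. C > 0 \<and> \<tau> > 0 \<and> (\<forall>\<xi>\<in>frontier \<Omega>.
        ball \<xi> \<tau> \<subseteq> V \<xi> \<and>
        (\<forall>p\<in>\<Phi> \<xi> ` (V \<xi> \<inter> \<Omega>). \<forall>v. v \<noteq> 0 \<longrightarrow>
            bdist_dir (\<Phi> \<xi> ` (V \<xi> \<inter> \<Omega>)) p v \<le> C * bdist (\<Phi> \<xi> ` (V \<xi> \<inter> \<Omega>)) p powr (1 / real L)) \<and>
        (\<forall>p\<in>V \<xi>. \<forall>q\<in>V \<xi>. norm (p - q) / C \<le> norm (\<Phi> \<xi> p - \<Phi> \<xi> q) \<and>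
                           norm (\<Phi> \<xi> p - \<Phi> \<xi> q) \<le> C * norm (p - q))))"

end

theory Submission
  imports Defs
begin

text \<open>
  Idea. Royden's localization lemma compares the two metrics infinitesimally: for \<open>x\<close> near
  \<open>\<xi>\<close> the ratio of the local to the global infinitesimal metric is at most \<open>1 + K u(x)^e\<close>, where
  \<open>u(x)\<close> is the distance from the chart image of \<open>x\<close> to the boundary of the convex model, because a
  disc that starts at height \<open>u\<close> must travel a hyperbolic distance of order \<open>log (1/u)\<close> before it
  leaves the chart. Since the Kobayashi distance in the model is at most
  \<open>B - A log u(x) - A log u(y)\<close>, the height along an almost-geodesic decays exponentially in the arc
  length away from its highest point. Hence \<open>u^e\<close> has bounded integral along it, and
  localization costs only an additive constant as long as the almost-geodesic stays near \<open>\<xi>\<close>.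
  The line estimate \<open>bdist_dir \<le> C bdist^(1/L)\<close> bounds Euclidean speed by \<open>u^(1/L)\<close>, so an
  almost-geodesic that leaves a neighbourhood of \<open>\<xi>\<close> climbs to a definite height both on the way
  out and on the way back; between these two high points the local distance is bounded.
  All metric arguments use chains of short disc steps, so infinitesimal metrics never appear.
\<close>

unbundle no fps_syntax

section \<open>Discs, hyperbolic steps and the Kobayashi distance\<close>

text \<open>The constants must serve all boundary points and all pairs of points at once. The step
  size \<open>\<eta>\<close> is fixed only after the distance of the given pair is known, so no
  constant may depend on it. The infimum in the Kobayashi distance need not be attained; a chain
  within 1 of it plays the geodesic, and that loss is absorbed by the constants. The decay of
  heights needs no lower bound for the distance: a piece of an almost-geodesic is at most 1 longer
  than the global distance of its ends, which monotonicity bounds by the local distance and hence by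
  the explicit upper bound in the model. All bounds on how fast a disc moves come from Schwarz's
  lemma for the half plane, applied to a disc followed by a complex-linear functional. Functionals
  separating outside points from the convex model control speed and growth of the height; a
  functional along the displacement itself gives a crude speed in the bounded set
  \<open>\<Omega>\<close>, where nothing is convex.\<close>

lemma halfplane_schwarz:
  fixes h :: "complex \<Rightarrow> complex"
  assumes holo: "h holomorphic_on ball 0 1"
    and pos: "\<And>z. z \<in> ball 0 1 \<Longrightarrow> 0 < Re (h z)"
    and z: "cmod z < 1"
  shows "cmod (h z - h 0) \<le> 2 * Re (h 0) * (cmod z / (1 - cmod z))"
proof -
  \<comment> \<open>Cayley transform of the right half plane onto the disc taking \<open>h 0\<close>
    to 0, so that Schwarz's lemma applies. Solving for \<open>h z - h 0\<close> leaves that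
    difference on both sides, whence the denominator \<open>1 - cmod z\<close>.\<close>
  define \<phi> where "\<phi> w = (h w - h 0) / (h w + cnj (h 0))" for w
  have h0: "0 < Re (h 0)" using pos by simp
  have nz: "h w + cnj (h 0) \<noteq> 0" if "w \<in> ball 0 1" for w
    using pos[OF that] h0 by (auto simp: complex_eq_iff)
  have hol: "\<phi> holomorphic_on ball 0 1"
    unfolding \<phi>_def using nz by (auto intro!: holomorphic_intros holo)
  have lt: "cmod (\<phi> w) < 1" if w: "cmod w < 1" for w
  proof -
    have p: "0 < Re (h w)" using pos w by simp
    have "(cmod (h w + cnj (h 0)))\<^sup>2 - (cmod (h w - h 0))\<^sup>2 = 4 * Re (h w) * Re (h 0)"
      unfolding cmod_power2 by (simp add: power2_eq_square algebra_simps)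
    moreover have "0 < 4 * Re (h w) * Re (h 0)" using p h0 by simp
    ultimately have "(cmod (h w - h 0))\<^sup>2 < (cmod (h w + cnj (h 0)))\<^sup>2" by linarith
    hence "cmod (h w - h 0) < cmod (h w + cnj (h 0))"
      by (simp add: power_less_imp_less_base)
    thus ?thesis by (simp add: \<phi>_def norm_divide divide_less_eq)
  qed
  have le: "cmod (\<phi> z) \<le> cmod z"
    using Schwarz_Lemma(1)[OF hol _ lt z] by (simp add: \<phi>_def)
  have "h z - h 0 = \<phi> z * (h z + cnj (h 0))"
    using nz z by (simp add: \<phi>_def)
  hence "cmod (h z - h 0) = cmod (\<phi> z) * cmod (h z + cnj (h 0))" by (simp add: norm_mult)
  also have "\<dots> \<le> cmod z * cmod (h z + cnj (h 0))" using le by (intro mult_right_mono) auto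
  also have "h z + cnj (h 0) = (h z - h 0) + of_real (2 * Re (h 0))"
    by (simp add: complex_eq_iff)
  also have "cmod z * cmod \<dots> \<le> cmod z * (cmod (h z - h 0) + 2 * Re (h 0))"
  proof (intro mult_left_mono order.trans[OF norm_triangle_ineq])
    show "cmod (h z - h 0) + cmod (complex_of_real (2 * Re (h 0))) \<le> cmod (h z - h 0) + 2 * Re (h 0)"
      using h0 by (simp only: norm_of_real)
  qed simp
  finally have "cmod (h z - h 0) * (1 - cmod z) \<le> 2 * Re (h 0) * cmod z"
    by (simp add: algebra_simps)
  thus ?thesis using z by (simp add: field_simps)
qed

section \<open>Elementary estimates for tanh and artanh\<close>

lemma tanh_le_self:
  fixes x :: real
  assumes "0 \<le> x"
  shows "tanh x \<le> x"
proof -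
  have "((\<lambda>x. x - tanh x) has_real_derivative 1 - (1 - tanh y ^ 2)) (at y)" for y :: real
    by (auto intro!: derivative_eq_intros)
  hence "\<exists>d. ((\<lambda>x. x - tanh x) has_real_derivative d) (at y) \<and> 0 \<le> d" for y :: real
    by (intro exI[of _ "1 - (1 - tanh y ^ 2)"] conjI) auto
  hence "0 - tanh 0 \<le> x - tanh x"
    by (intro DERIV_nonneg_imp_nondecreasing[OF assms, of "\<lambda>x. x - tanh x"]) blast
  thus ?thesis by simp
qed

lemma tanh_artanh_real:
  fixes x :: real
  assumes "\<bar>x\<bar> < 1"
  shows "tanh (artanh x) = x"
proof -
  have "0 < (1 + x) / (1 - x)" using assms by simp
  hence e: "exp (- 2 * artanh x) = (1 - x) / (1 + x)"
    by (simp add: artanh_def exp_minus)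
  show ?thesis unfolding tanh_real_altdef e using assms by (simp add: divide_simps)
qed

lemma artanh_le:
  fixes y :: real
  assumes "0 \<le> y" "y < 1"
  shows "artanh y \<le> y / (1 - y)"
proof -
  have "ln ((1 + y) / (1 - y)) \<le> (1 + y) / (1 - y) - 1"
    using assms by (intro ln_le_minus_one) simp
  also have "\<dots> = 2 * (y / (1 - y))" using assms by (simp add: field_simps)
  finally show ?thesis unfolding artanh_def by linarith
qed

lemma one_minus_tanh_le:
  "1 - tanh x \<le> 2 * exp (- 2 * x)" for x :: real
proof -
  have "1 - (1 - y) / (1 + y) = 2 * y / (1 + y)" if "0 < y" for y :: real
    using that by (simp add: field_simps)
  from this[of "exp (-2 * x)"] have "1 - tanh x = 2 * exp (-2 * x) / (1 + exp (-2*x))"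
    unfolding tanh_real_altdef by simp
  also have "\<dots> \<le> 2 * exp (-2 * x) / 1" by (intro divide_left_mono) (auto intro: add_pos_pos)
  finally show ?thesis by simp
qed

section \<open>Chains of short disc steps\<close>

definition hstep :: "(complex^'n) set \<Rightarrow> complex^'n \<Rightarrow> complex^'n \<Rightarrow> real \<Rightarrow> bool" where
  "hstep \<Omega> x y l \<longleftrightarrow> 0 \<le> l \<and>
     (\<exists>f. holo_disc f \<and> f ` ball 0 1 \<subseteq> \<Omega> \<and> f 0 = x \<and> f (of_real (tanh l)) = y)"

text \<open>A step's disc is centred at its starting point and meets its end at
  \<open>tanh l\<close>, so \<open>l\<close> is a Poincare length. The cap \<open>\<eta>\<close> is
  kept apart from the lengths so that a chain can be refined without changing its total.\<close>

definition hpath ::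
  "(complex^'n) set \<Rightarrow> real \<Rightarrow> (nat \<Rightarrow> complex^'n) \<Rightarrow> (nat \<Rightarrow> real) \<Rightarrow> nat \<Rightarrow> bool" where
  "hpath \<Omega> \<eta> x l N \<longleftrightarrow> (\<forall>k<N. hstep \<Omega> (x k) (x (Suc k)) (l k) \<and> l k \<le> \<eta>)"

definition hconn :: "(complex^'n) set \<Rightarrow> real \<Rightarrow> complex^'n \<Rightarrow> complex^'n \<Rightarrow> real \<Rightarrow> bool" where
  "hconn \<Omega> \<eta> p q T \<longleftrightarrow> (\<exists>x l N. hpath \<Omega> \<eta> x l N \<and> x 0 = p \<and> x N = q \<and> (\<Sum>k<N. l k) = T)"

lemma tanh_in_ball [simp]: "complex_of_real (tanh l) \<in> ball 0 1"
  using tanh_real_bounds[of l] by (simp add: abs_less_iff)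

lemma holo_disc_compose:
  assumes "holo_disc f" "\<phi> holomorphic_on ball 0 1" "\<phi> ` ball 0 1 \<subseteq> ball 0 1"
  shows "holo_disc (\<lambda>z. f (\<phi> z))"
  using assms holomorphic_on_compose_gen[of \<phi> "ball 0 1" _ "ball 0 1"]
  unfolding holo_disc_def o_def by blast

lemma one_minus_cnj_mult_nonzero:
  assumes "cmod a < 1" "cmod b < 1"
  shows "1 - cnj a * b \<noteq> 0"
proof
  assume "1 - cnj a * b = 0"
  hence "cmod (cnj a * b) = 1" by simp
  moreover have "cmod a * cmod b < 1 * 1" using assms by (intro mult_strict_mono') auto
  ultimately show False by (simp add: norm_mult)
qed

lemma moebius_norm_lt_1:
  assumes "cmod a < 1" "cmod b < 1"
  shows "cmod ((a - b) / (1 - cnj a * b)) < 1"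
  using Moebius_function_norm_lt_1[OF assms, of 0]
  unfolding Moebius_function_simple by (simp add: norm_divide norm_minus_commute)

lemma poincare_dist_nonneg:
  assumes "cmod a < 1" "cmod b < 1"
  shows "0 \<le> poincare_dist a b"
proof -
  have "tanh (poincare_dist a b) = cmod ((a - b) / (1 - cnj a * b))"
    unfolding poincare_dist_def
    by (rule tanh_artanh_real) (use moebius_norm_lt_1[OF assms] in simp)
  hence "0 \<le> tanh (poincare_dist a b)" by simp
  thus ?thesis by (simp only: tanh_real_nonneg_iff)
qed

text \<open>Automorphisms of the disc preserve the Poincare distance, so the disc may be
  reparametrised to start at 0 and to meet the second point on the positive radius.\<close>

lemma hstep_of_disc:
  assumes f: "holo_disc f" "f ` ball 0 1 \<subseteq> \<Omega>" and a: "cmod a < 1" and b: "cmod b < 1"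
  shows "hstep \<Omega> (f a) (f b) (poincare_dist a b)"
proof -
  define w where "w = (b - a) / (1 - cnj a * b)"
  define t where "t = cmod ((a - b) / (1 - cnj a * b))"
  have t: "t = cmod w" by (simp add: t_def w_def norm_divide norm_minus_commute)
  have t1: "0 \<le> t" "t < 1" using moebius_norm_lt_1[OF a b] by (auto simp: t_def)
  have ta: "tanh (poincare_dist a b) = t"
    using t1 by (simp add: poincare_dist_def tanh_artanh_real flip: t_def)
  have nz: "1 - cnj a * b \<noteq> 0" by (rule one_minus_cnj_mult_nonzero[OF a b])
  obtain u where u: "cmod u = 1" "w = u * t"
  proof (cases "w = 0")
    case True thus ?thesis using that[of 1] t by simp
  next
    case False
    have "cmod (w / t) = 1" using False t by (simp add: norm_divide)
    moreover have "w = w / t * t" using False t by simp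
    ultimately show ?thesis by (rule that)
  qed
  \<comment> \<open>The rotation \<open>u\<close> carries the positive real number \<open>t\<close>
    to \<open>w\<close>; the Moebius map then carries 0 to \<open>a\<close> and \<open>w\<close> to
    \<open>b\<close>.\<close>
  define \<phi> where "\<phi> z = Moebius_function 0 (-a) (u * z)" for z
  have um: "(\<lambda>z. u * z) ` ball 0 1 \<subseteq> ball 0 1" using u by (auto simp: norm_mult)
  have "(Moebius_function 0 (-a) \<circ> (\<lambda>z. u * z)) holomorphic_on ball 0 1"
    by (rule holomorphic_on_compose_gen[OF _ _ um])
       (auto intro!: holomorphic_intros Moebius_function_holomorphic simp: a)
  hence hol: "\<phi> holomorphic_on ball 0 1" by (simp add: \<phi>_def[abs_def] o_def)
  have im: "\<phi> ` ball 0 1 \<subseteq> ball 0 1"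
    using Moebius_function_norm_lt_1[of "-a" _ 0] a u by (auto simp: \<phi>_def norm_mult)
  have p0: "\<phi> 0 = a" by (simp add: \<phi>_def Moebius_function_simple)
  have nz2: "1 - cnj (-a) * w \<noteq> 0"
    by (rule one_minus_cnj_mult_nonzero) (use a t t1 in auto)
  have "\<phi> t = (w + a) / (1 + cnj a * w)"
    by (simp add: \<phi>_def Moebius_function_simple u(2))
  also have "\<dots> = b"
  proof -
    have "(w + a) = b * (1 + cnj a * w)"
      unfolding w_def using nz by (simp add: divide_simps) (simp add: algebra_simps)
    thus ?thesis using nz2 by simp
  qed
  finally have pt: "\<phi> t = b" .
  have "holo_disc (\<lambda>z. f (\<phi> z))" by (rule holo_disc_compose[OF f(1) hol im])
  moreover have "(\<lambda>z. f (\<phi> z)) ` ball 0 1 \<subseteq> \<Omega>" using f(2) im by blast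
  ultimately show ?thesis
    unfolding hstep_def using p0 pt ta poincare_dist_nonneg[OF a b]
    by (intro conjI exI[of _ "\<lambda>z. f (\<phi> z)"]) auto
qed

text \<open>The addition formula for tanh: a radius parametrised by tanh is a unit-speed geodesic,
  so a long step can be cut into short ones without loss.\<close>

lemma poincare_dist_tanh:
  assumes "a \<le> b"
  shows "poincare_dist (of_real (tanh a)) (of_real (tanh b)) = b - a"
proof -
  have "(tanh b - tanh a) / (1 - tanh a * tanh b) = tanh (b - a)"
    using tanh_add[of b "-a"] by (simp add: algebra_simps)
  hence "cmod ((of_real (tanh a) - of_real (tanh b)) / (1 - cnj (of_real (tanh a)) * of_real (tanh b)))
      = \<bar>- tanh (b - a)\<bar>"
    by (metis (no_types, opaque_lifting) complex_cnj_complex_of_real minus_diff_eq minus_divide_left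
        norm_of_real of_real_1 of_real_diff of_real_divide of_real_mult)
  thus ?thesis unfolding poincare_dist_def using assms by (simp add: artanh_tanh_real)
qed

lemma hconn_append:
  assumes "hconn \<Omega> \<eta> p q S" "hconn \<Omega> \<eta> q r T"
  shows "hconn \<Omega> \<eta> p r (S + T)"
proof -
  obtain x l N where 1: "hpath \<Omega> \<eta> x l N" "x 0 = p" "x N = q" "(\<Sum>k<N. l k) = S"
    using assms(1) unfolding hconn_def by blast
  obtain y m M where 2: "hpath \<Omega> \<eta> y m M" "y 0 = q" "y M = r" "(\<Sum>k<M. m k) = T"
    using assms(2) unfolding hconn_def by blast
  define z where "z k = (if k \<le> N then x k else y (k - N))" for k
  define j where "j k = (if k < N then l k else m (k - N))" for k
  have "hpath \<Omega> \<eta> z j (N + M)"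
    unfolding hpath_def
  proof (intro allI impI)
    fix k assume k: "k < N + M"
    show "hstep \<Omega> (z k) (z (Suc k)) (j k) \<and> j k \<le> \<eta>"
    proof (cases "k < N")
      case True thus ?thesis using 1(1) by (simp add: hpath_def z_def j_def)
    next
      case False
      have "z k = y (k - N)" "z (Suc k) = y (Suc (k - N))" "j k = m (k - N)"
        using False 1(3) 2(2) by (auto simp: z_def j_def Suc_diff_le)
      thus ?thesis using 2(1) k False by (simp add: hpath_def)
    qed
  qed
  moreover have "z 0 = p" "z (N + M) = r" using 1 2 by (auto simp: z_def)
  moreover have "(\<Sum>k<N+M. j k) = S + T"
  proof -
    have "(\<Sum>k<N+M. j k) = (\<Sum>k<N. j k) + (\<Sum>k<M. j (N + k))"
      by (induction M) (auto simp: add.assoc)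
    thus ?thesis using 1(4) 2(4) by (simp add: j_def)
  qed
  ultimately show ?thesis unfolding hconn_def by blast
qed

lemma hconn_of_hstep:
  assumes "hstep \<Omega> x y L" "0 < \<eta>"
  shows "hconn \<Omega> \<eta> x y L"
proof -
  obtain f where f: "holo_disc f" "f ` ball 0 1 \<subseteq> \<Omega>" "f 0 = x" "f (of_real (tanh L)) = y"
    and L: "0 \<le> L" using assms(1) unfolding hstep_def by blast
  \<comment> \<open>The strict inequality makes \<open>N\<close> positive even when
    \<open>L = 0\<close>, so \<open>L / N\<close> is a genuine quotient.\<close>
  obtain N :: nat where N: "L / \<eta> < real N" using reals_Archimedean2 by blast
  have N0: "0 < real N" using N L assms(2) by (smt (verit) divide_nonneg_pos)
  define h where "h = L / N"
  have h: "0 \<le> h" "h \<le> \<eta>" using N N0 L assms(2) by (auto simp: h_def field_simps)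
  have "hpath \<Omega> \<eta> (\<lambda>k. f (of_real (tanh (real k * h)))) (\<lambda>_. h) N"
    unfolding hpath_def
  proof (intro allI impI conjI h)
    fix k
    have "hstep \<Omega> (f (of_real (tanh (real k * h)))) (f (of_real (tanh (real (Suc k) * h))))
       (poincare_dist (of_real (tanh (real k * h))) (of_real (tanh (real (Suc k) * h))))"
      using tanh_in_ball by (intro hstep_of_disc[OF f(1,2)]) (auto simp del: tanh_in_ball)
    thus "hstep \<Omega> (f (of_real (tanh (real k * h)))) (f (of_real (tanh (real (Suc k) * h)))) h"
      by (subst (asm) poincare_dist_tanh) (use h in \<open>auto simp: algebra_simps\<close>)
  qed
  thus ?thesis unfolding hconn_def using f N0
    by (intro exI[of _ "\<lambda>k. f (of_real (tanh (real k * h)))"] exI[of _ "\<lambda>_. h"] exI[of _ N])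
       (auto simp: h_def)
qed

text \<open>Each disc of an almost optimal chain is cut along its geodesic into steps of length at
  most \<open>\<eta>\<close>. The total is unchanged, so \<open>\<eta>\<close> may be chosen after
  \<open>T\<close>.\<close>

lemma hconn_of_kobayashi_less:
  assumes "kobayashi_dist \<Omega> p q < ereal T" "0 < \<eta>"
  shows "\<exists>S<T. hconn \<Omega> \<eta> p q S"
proof -
  obtain n f a b where n: "0 < n"
    and d: "\<And>j. j < n \<Longrightarrow> holo_disc (f j) \<and> f j ` ball 0 1 \<subseteq> \<Omega> \<and> a j \<in> ball 0 1 \<and> b j \<in> ball 0 1"
    and e: "f 0 (a 0) = p" "f (n - 1) (b (n - 1)) = q"
    and c: "\<And>j. Suc j < n \<Longrightarrow> f j (b j) = f (Suc j) (a (Suc j))"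
    and T: "ereal (\<Sum>j<n. poincare_dist (a j) (b j)) < ereal T"
    using assms(1) unfolding kobayashi_dist_def Inf_less_iff by blast
  have "k < n \<Longrightarrow> hconn \<Omega> \<eta> p (f k (b k)) (\<Sum>j<Suc k. poincare_dist (a j) (b j))" for k
  proof (induction k)
    case 0
    show ?case using d[OF n] e(1) by (auto intro!: hconn_of_hstep[OF _ assms(2)] hstep_of_disc)
  next
    case (Suc k)
    have "hconn \<Omega> \<eta> (f k (b k)) (f (Suc k) (b (Suc k))) (poincare_dist (a (Suc k)) (b (Suc k)))"
      unfolding c[OF Suc.prems]
      using d[OF Suc.prems] by (intro hconn_of_hstep[OF _ assms(2)] hstep_of_disc) auto
    from hconn_append[OF Suc.IH this] Suc.prems show ?case by simp
  qed
  from this[of "n - 1"] n e(2) T show ?thesis by auto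
qed

lemma kobayashi_le_hpath:
  assumes "hpath \<Omega> \<eta> x l N" "x N \<in> \<Omega>"
  shows "kobayashi_dist \<Omega> (x 0) (x N) \<le> ereal (\<Sum>k<N. l k)"
proof (cases "N = 0")
  case True
  \<comment> \<open>The definition asks for at least one disc, so an empty path is realised by a
    constant disc, which lies in \<open>\<Omega>\<close> by the hypothesis on the endpoint.\<close>
  have "kobayashi_dist \<Omega> (x 0) (x 0) \<le> ereal (\<Sum>j<(1::nat). poincare_dist 0 0)"
    unfolding kobayashi_dist_def
    by (rule Inf_lower, rule CollectI, rule exI[of _ 1], rule exI[of _ "\<lambda>_ _. x 0"])
       (use assms True in \<open>auto intro!: exI[of _ "\<lambda>_. 0"] simp: holo_disc_def\<close>)
  thus ?thesis using True by (simp add: poincare_dist_def)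
next
  case False
  have "\<forall>k. \<exists>f. k < N \<longrightarrow> holo_disc f \<and> f ` ball 0 1 \<subseteq> \<Omega> \<and> f 0 = x k \<and> f (of_real (tanh (l k))) = x (Suc k)"
    using assms(1) unfolding hpath_def hstep_def by blast
  then obtain f where f: "\<And>k. k < N \<Longrightarrow> holo_disc (f k) \<and> f k ` ball 0 1 \<subseteq> \<Omega> \<and> f k 0 = x k \<and>
      f k (of_real (tanh (l k))) = x (Suc k)" by metis
  have "f (N - 1) (of_real (tanh (l (N - 1)))) = x N" using f[of "N - 1"] False by simp
  hence "kobayashi_dist \<Omega> (x 0) (x N) \<le> ereal (\<Sum>j<N. poincare_dist 0 (of_real (tanh (l j))))"
    unfolding kobayashi_dist_def
    by (intro Inf_lower CollectI exI[of _ N] exI[of _ f] exI[of _ "\<lambda>_. 0"]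
        exI[of _ "\<lambda>j. complex_of_real (tanh (l j))"] conjI refl)
       (use f False tanh_in_ball in \<open>auto simp del: mem_ball simp: centre_in_ball\<close>)
  also have "(\<Sum>j<N. poincare_dist 0 (of_real (tanh (l j)))) = (\<Sum>j<N. l j)"
  proof (rule sum.cong)
    fix j assume "j \<in> {..<N}"
    hence "0 \<le> l j" using assms(1) by (simp add: hpath_def hstep_def)
    thus "poincare_dist 0 (of_real (tanh (l j))) = l j"
      using poincare_dist_tanh[of 0 "l j"] by simp
  qed simp
  finally show ?thesis .
qed

lemma kobayashi_le_hconn:
  "hconn \<Omega> \<eta> p q T \<Longrightarrow> q \<in> \<Omega> \<Longrightarrow> kobayashi_dist \<Omega> p q \<le> ereal T"
  unfolding hconn_def using kobayashi_le_hpath by blast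

lemma kobayashi_le_hstep:
  assumes "hstep \<Omega> x y l"
  shows "kobayashi_dist \<Omega> x y \<le> ereal l"
proof (rule kobayashi_le_hconn)
  show "hconn \<Omega> 1 x y l" using hconn_of_hstep[OF assms] by simp
  show "y \<in> \<Omega>" using assms tanh_in_ball unfolding hstep_def by blast
qed

section \<open>The triangle inequality\<close>

lemma kobayashi_refl_le: "x \<in> \<Omega> \<Longrightarrow> kobayashi_dist \<Omega> x x \<le> 0"
  using kobayashi_le_hpath[of \<Omega> 0 "\<lambda>_. x" "\<lambda>_. 0" 0] by (simp add: hpath_def zero_ereal_def)

text \<open>The bounds are real numbers, so no sum with an infinite distance arises. Both distances
  are approximated by chains up to \<open>e/2\<close>, and the chains are concatenated.\<close>

lemma kobayashi_triangle:
  assumes "kobayashi_dist \<Omega> x y \<le> ereal S" "kobayashi_dist \<Omega> y z \<le> ereal T" "z \<in> \<Omega>"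
  shows "kobayashi_dist \<Omega> x z \<le> ereal (S + T)"
proof (rule ereal_le_epsilon2)
  fix e :: real assume e: "0 < e"
  have "kobayashi_dist \<Omega> x y < ereal (S + e/2)" "kobayashi_dist \<Omega> y z < ereal (T + e/2)"
    using assms(1,2) e by (auto intro: le_less_trans)
  from this[THEN hconn_of_kobayashi_less, of 1]
  obtain S' T' where 1: "S' < S + e/2" "T' < T + e/2" "hconn \<Omega> 1 x y S'" "hconn \<Omega> 1 y z T'"
    by auto
  from kobayashi_le_hconn[OF hconn_append[OF 1(3,4)] assms(3)]
  have "kobayashi_dist \<Omega> x z \<le> ereal (S' + T')" .
  also have "\<dots> \<le> ereal (S + T) + ereal e" using 1 by simp
  finally show "kobayashi_dist \<Omega> x z \<le> ereal (S + T) + ereal e" .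
qed

lemma kobayashi_chain:
  assumes "m \<le> k" "x k \<in> \<Omega>"
    "\<And>j. m \<le> j \<Longrightarrow> j < k \<Longrightarrow> x j \<in> \<Omega> \<and> kobayashi_dist \<Omega> (x j) (x (Suc j)) \<le> ereal (t j)"
  shows "kobayashi_dist \<Omega> (x m) (x k) \<le> ereal (\<Sum>j=m..<k. t j)"
  using assms
proof (induction k rule: dec_induct)
  case base thus ?case using kobayashi_refl_le[of "x m"] by (simp add: zero_ereal_def)
next
  case (step k)
  have "kobayashi_dist \<Omega> (x m) (x k) \<le> ereal (\<Sum>j=m..<k. t j)"
    using step by (intro step.IH) (use step in auto)
  from kobayashi_triangle[OF this, of "x (Suc k)" "t k"] step show ?case by simp
qed

section \<open>Holomorphic maps contract the Kobayashi distance\<close>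

lemma has_derivative_vec_components:
  fixes f :: "'a::real_normed_vector \<Rightarrow> complex^'n"
  assumes "\<And>i. ((\<lambda>x. f x $ i) has_derivative (\<lambda>h. D h $ i)) (at a within S)"
  shows "(f has_derivative D) (at a within S)"
  unfolding has_derivative_componentwise_within[of f D]
proof
  fix b :: "complex^'n" assume "b \<in> Basis"
  then obtain i c where b: "b = axis i c" by (auto simp: Basis_vec_def)
  have "((\<lambda>x. f x $ i \<bullet> c) has_derivative (\<lambda>h. D h $ i \<bullet> c)) (at a within S)"
    by (rule has_derivative_inner_left[OF assms])
  thus "((\<lambda>x. f x \<bullet> b) has_derivative (\<lambda>h. D h \<bullet> b)) (at a within S)"
    by (simp add: b inner_axis)
qed

text \<open>By the chain rule the composite has a real derivative; complex homogeneity of the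
  derivative of \<open>F\<close> turns it into multiplication by a complex number, that is, a
  complex derivative.\<close>

lemma holo_disc_cholo:
  assumes f: "holo_disc f" "f ` ball 0 1 \<subseteq> S" and F: "cholo_on F S"
  shows "holo_disc (\<lambda>z. F (f z))"
  unfolding holo_disc_def
proof
  fix i
  have "(\<lambda>z. F (f z) $ i) field_differentiable (at z)" if z: "z \<in> ball 0 1" for z
  proof -
    have "\<exists>c. ((\<lambda>z. f z $ j) has_field_derivative c) (at z)" for j
      using f(1) z unfolding holo_disc_def
      by (meson holomorphic_on_imp_differentiable_at open_ball field_differentiable_def)
    then obtain c where c: "\<And>j. ((\<lambda>z. f z $ j) has_field_derivative c j) (at z)" by metis
    have fd: "(f has_derivative (\<lambda>h. h *s (\<chi> j. c j))) (at z)"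
      by (rule has_derivative_vec_components)
         (use c in \<open>simp add: has_field_derivative_def mult.commute[of _ "c _"]\<close>)
    obtain D where D: "(F has_derivative D) (at (f z))" "\<And>c v. D (c *s v) = c *s D v"
      using F f(2) z unfolding cholo_on_def by blast
    have "((\<lambda>z. F (f z)) has_derivative (\<lambda>h. D (h *s (\<chi> j. c j)))) (at z)"
      by (rule has_derivative_compose[OF fd D(1)])
    hence "((\<lambda>z. F (f z) $ i) has_derivative (\<lambda>h. D (h *s (\<chi> j. c j)) $ i)) (at z)"
      by (rule bounded_linear.has_derivative[OF bounded_linear_vec_nth])
    hence "((\<lambda>z. F (f z) $ i) has_field_derivative (D (\<chi> j. c j) $ i)) (at z)"
      unfolding has_field_derivative_def D(2) vector_smult_component
      by (rule has_derivative_eq_rhs) (simp add: fun_eq_iff mult.commute)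
    thus ?thesis by (auto simp: field_differentiable_def)
  qed
  thus "(\<lambda>z. F (f z) $ i) holomorphic_on ball 0 1"
    by (simp add: holomorphic_on_def field_differentiable_at_within)
qed

lemma kobayashi_contract:
  assumes F: "cholo_on F S" "F ` S \<subseteq> S'"
  shows "kobayashi_dist S' (F x) (F y) \<le> kobayashi_dist S x y"
  unfolding kobayashi_dist_def
proof (rule Inf_superset_mono, rule subsetI)
  fix t
  assume "t \<in> {ereal (\<Sum>j<n. poincare_dist (a j) (b j)) | n f a b.
      0 < n \<and>
      (\<forall>j<n. holo_disc (f j) \<and> f j ` ball 0 1 \<subseteq> S \<and> a j \<in> ball 0 1 \<and> b j \<in> ball 0 1) \<and>
      f 0 (a 0) = x \<and> f (n - 1) (b (n - 1)) = y \<and>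
      (\<forall>j. Suc j < n \<longrightarrow> f j (b j) = f (Suc j) (a (Suc j)))}"
  then obtain n f a b where t: "t = ereal (\<Sum>j<n. poincare_dist (a j) (b j))" and
    *: "0 < n" "\<And>j. j < n \<Longrightarrow> holo_disc (f j)" "\<And>j. j < n \<Longrightarrow> f j ` ball 0 1 \<subseteq> S" 
       "\<And>j. j < n \<Longrightarrow> a j \<in> ball 0 1 \<and> b j \<in> ball 0 1"
      "f 0 (a 0) = x" "f (n - 1) (b (n - 1)) = y"
      "\<And>j. Suc j < n \<Longrightarrow> f j (b j) = f (Suc j) (a (Suc j))" by blast
  have "(\<lambda>z. F (f j z)) ` ball 0 1 \<subseteq> S'" if "j < n" for j
    using *(3)[OF that] F(2) by blast
  thus "t \<in> {ereal (\<Sum>j<n. poincare_dist (a j) (b j)) | n f a b.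
      0 < n \<and>
      (\<forall>j<n. holo_disc (f j) \<and> f j ` ball 0 1 \<subseteq> S' \<and> a j \<in> ball 0 1 \<and> b j \<in> ball 0 1) \<and>
      f 0 (a 0) = F x \<and> f (n - 1) (b (n - 1)) = F y \<and>
      (\<forall>j. Suc j < n \<longrightarrow> f j (b j) = f (Suc j) (a (Suc j)))}"
    using * holo_disc_cholo[OF *(2,3) F(1)]
    by (intro CollectI exI[of _ n] exI[of _ "\<lambda>j z. F (f j z)"] exI[of _ a] exI[of _ b])
       (auto simp: t)
qed

lemma kobayashi_mono:
  "S \<subseteq> S' \<Longrightarrow> kobayashi_dist S' x y \<le> kobayashi_dist S x y"
proof -
  have "cholo_on (\<lambda>x. x) S"
    unfolding cholo_on_def using has_derivative_ident by blast
  thus "S \<subseteq> S' \<Longrightarrow> kobayashi_dist S' x y \<le> kobayashi_dist S x y"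
    using kobayashi_contract[of "\<lambda>x. x" S S' x y] by simp
qed

section \<open>Discs in convex domains\<close>

text \<open>The complex-linear functional whose real part is the real inner product with
  \<open>a\<close>. It turns a real hyperplane beside a convex domain into a holomorphic function
  with values in a half plane.\<close>

definition hermitian_form :: "complex^'n \<Rightarrow> complex^'n \<Rightarrow> complex" where
  "hermitian_form a z = (\<Sum>i\<in>UNIV. cnj (a $ i) * z $ i)"

lemma Re_hermitian_form: "Re (hermitian_form a z) = a \<bullet> z"
  by (simp add: hermitian_form_def inner_vec_def inner_complex_def)

lemma hermitian_form_diff: "hermitian_form a (x - y) = hermitian_form a x - hermitian_form a y"
  by (simp add: hermitian_form_def algebra_simps sum_subtractf)

lemma hermitian_form_scale: "hermitian_form a (c *s x) = c * hermitian_form a x"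
  by (simp add: hermitian_form_def sum_distrib_left algebra_simps)

text \<open>Separation gives only a weak inequality. Openness makes it strict, since
  \<open>x\<close> can be pushed a little in the direction \<open>a\<close> without leaving
  \<open>D\<close>.\<close>

lemma open_convex_support:
  fixes D :: "'a::euclidean_space set"
  assumes "open D" "convex D" "D \<noteq> {}" "q \<notin> D"
  obtains a where "a \<noteq> 0" "\<And>x. x \<in> D \<Longrightarrow> a \<bullet> x < a \<bullet> q"
proof -
  obtain a b where ab: "a \<noteq> 0" "\<forall>x\<in>D. a \<bullet> x \<le> b" "\<forall>x\<in>{q}. b \<le> a \<bullet> x"
    using separating_hyperplane_sets[of D "{q}"] assms by auto
  have "a \<bullet> x < a \<bullet> q" if x: "x \<in> D" for x
  proof -
    obtain e where e: "0 < e" "cball x e \<subseteq> D"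
      using assms(1) x open_contains_cball by blast
    have "x + (e / norm a) *\<^sub>R a \<in> D" using e ab(1) by (intro subsetD[OF e(2)]) (simp add: dist_norm)
    hence "a \<bullet> (x + (e / norm a) *\<^sub>R a) \<le> a \<bullet> q" using ab by force
    moreover have "0 < a \<bullet> ((e / norm a) *\<^sub>R a)" using ab(1) e by simp
    ultimately show ?thesis by (simp add: inner_add_right)
  qed
  thus ?thesis using that ab(1) by blast
qed

lemma hermitian_form_holomorphic:
  "holo_disc g \<Longrightarrow> (\<lambda>z. hermitian_form a (g z)) holomorphic_on ball 0 1"
  unfolding hermitian_form_def holo_disc_def by (intro holomorphic_intros) auto

text \<open>The half-plane Schwarz lemma for \<open>c - hermitian_form a (g w)\<close>. The bound is
  proportional to the gap between the centre and the hyperplane, so discs centred near the boundary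
  move slowly across it.\<close>

lemma hermitian_form_schwarz:
  assumes g: "holo_disc g" "\<And>z. z \<in> ball 0 1 \<Longrightarrow> a \<bullet> g z < c" and z: "cmod z < 1"
  shows "cmod (hermitian_form a (g z - g 0)) \<le> 2 * (c - a \<bullet> g 0) * (cmod z / (1 - cmod z))"
proof -
  define h where "h w = of_real c - hermitian_form a (g w)" for w
  have "cmod (h z - h 0) \<le> 2 * Re (h 0) * (cmod z / (1 - cmod z))"
    using g hermitian_form_holomorphic[OF g(1)]
    by (intro halfplane_schwarz z) (auto simp: h_def Re_hermitian_form intro!: holomorphic_intros)
  thus ?thesis by (simp add: h_def Re_hermitian_form hermitian_form_diff norm_minus_commute)
qed

lemma infdist_greatest:
  assumes "A \<noteq> {}" "\<And>a. a \<in> A \<Longrightarrow> c \<le> dist x a"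
  shows "c \<le> infdist x A"
  using assms by (simp add: infdist_notempty cINF_greatest)

lemma bounded_not_univ: "bounded S \<Longrightarrow> UNIV - S \<noteq> ({} :: 'a::euclidean_space set)"
  using not_bounded_UNIV by (metis Diff_eq_empty_iff bounded_subset)

lemma norm_scale_vec: "norm (c *s v) = cmod c * norm (v :: complex^'n)"
  by (simp add: norm_vec_def norm_mult L2_set_right_distrib)

text \<open>Ensures that the directional distance is an infimum over a nonempty set, not the default
  value 0 of \<open>infdist\<close> on the empty set.\<close>

lemma complex_line_not_bounded:
  assumes "bounded S" "v \<noteq> (0 :: complex^'n)"
  shows "range (\<lambda>z::complex. p + z *s v) - S \<noteq> {}"
proof -
  obtain B where B: "\<And>x. x \<in> S \<Longrightarrow> norm x \<le> B" using assms(1) by (auto simp: bounded_iff)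
  define t where "t = (\<bar>B\<bar> + norm p + 1) / norm v"
  have "norm (of_real t *s v) = \<bar>B\<bar> + norm p + 1"
    unfolding norm_scale_vec norm_of_real using assms(2) by (simp add: t_def)
  hence "\<bar>B\<bar> + 1 \<le> norm (p + of_real t *s v)"
    using norm_triangle_ineq4[of "p + of_real t *s v" p] by simp
  hence "p + of_real t *s v \<notin> S" using B by fastforce
  thus ?thesis by blast
qed

text \<open>Let \<open>q = g 0 + l *s v\<close> be a point outside \<open>D\<close> on the line of
  the displacement \<open>v\<close>. A functional separating \<open>q\<close> from \<open>D\<close>
  has gap \<open>Re (l * hermitian_form a v)\<close> at \<open>g 0\<close>. The gap is positive, so
  \<open>hermitian_form a v\<close> is nonzero and cancels from the Schwarz bound, leaving
  \<open>1 \<le> 2 * cmod l * \<sigma>\<close>: a lower bound for the distance to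
  \<open>q\<close>.\<close>

lemma convex_disc_displacement:
  assumes D: "open D" "convex D" "bounded D"
    and g: "holo_disc g" "g ` ball 0 1 \<subseteq> D" and z: "cmod z < 1" and ne: "g z \<noteq> g 0"
  shows "norm (g z - g 0) \<le> bdist_dir D (g 0) (g z - g 0) * (2 * (cmod z / (1 - cmod z)))"
proof -
  define v where "v = g z - g 0"
  define \<sigma> where "\<sigma> = cmod z / (1 - cmod z)"
  have z0: "z \<noteq> 0" using ne by auto
  hence \<sigma>: "0 < \<sigma>" using z by (simp add: \<sigma>_def)
  have v: "v \<noteq> 0" using ne by (simp add: v_def)
  have g0: "g 0 \<in> D" using g(2) by auto
  have "norm v / (2 * \<sigma>) \<le> infdist (g 0) (range (\<lambda>z. g 0 + z *s v) - D)"
  proof (rule infdist_greatest[OF complex_line_not_bounded[OF D(3) v]])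
    fix q assume "q \<in> range (\<lambda>z. g 0 + z *s v) - D"
    then obtain l where l: "q = g 0 + l *s v" and q: "q \<notin> D" by blast
    obtain a where a: "a \<noteq> 0" "\<And>x. x \<in> D \<Longrightarrow> a \<bullet> x < a \<bullet> q"
      using open_convex_support[OF D(1,2) _ q] g0 by blast
    have "a \<bullet> g w < a \<bullet> q" if "w \<in> ball 0 1" for w using a(2) g(2) that by blast
    from hermitian_form_schwarz[OF g(1) this z]
    have 1: "cmod (hermitian_form a v) \<le> 2 * (a \<bullet> q - a \<bullet> g 0) * \<sigma>" by (simp add: v_def \<sigma>_def)
    have 2: "a \<bullet> q - a \<bullet> g 0 = Re (l * hermitian_form a v)"
      unfolding Re_hermitian_form[symmetric] l
      by (simp flip: hermitian_form_diff hermitian_form_scale minus_complex.simps)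
    have "a \<bullet> q - a \<bullet> g 0 \<le> cmod l * cmod (hermitian_form a v)"
      unfolding 2 using complex_Re_le_cmod[of "l * hermitian_form a v"] by (simp add: norm_mult)
    hence "cmod (hermitian_form a v) \<le> 2 * (cmod l * cmod (hermitian_form a v)) * \<sigma>"
      using 1 \<sigma> by (meson mult_left_mono mult_right_mono order_trans less_imp_le zero_le_numeral)
    moreover have "hermitian_form a v \<noteq> 0" using 2 a(2)[OF g0] by auto
    ultimately have "1 \<le> 2 * cmod l * \<sigma>" by (simp add: mult.assoc mult.left_commute)
    hence "norm v * 1 \<le> norm v * (2 * cmod l * \<sigma>)" by (intro mult_left_mono) auto
    thus "norm v / (2 * \<sigma>) \<le> dist (g 0) q"
      using \<sigma> by (simp add: l dist_norm norm_scale_vec field_simps)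
  qed
  thus ?thesis using \<sigma> by (simp add: bdist_dir_def v_def \<sigma>_def[symmetric] field_simps)
qed

text \<open>For each outside point \<open>q\<close> the gap to a separating hyperplane grows at most
  by the factor \<open>1 + 2 * \<sigma>\<close> along the disc. At \<open>g z\<close> the gap bounds
  the height from above, at \<open>g 0\<close> it is at most \<open>norm a\<close> times the
  distance to \<open>q\<close>.\<close>

lemma convex_disc_bdist:
  assumes D: "open D" "convex D" "bounded D"
    and g: "holo_disc g" "g ` ball 0 1 \<subseteq> D" and z: "cmod z < 1"
  shows "bdist D (g z) \<le> bdist D (g 0) * (1 + 2 * (cmod z / (1 - cmod z)))"
proof -
  define \<sigma> where "\<sigma> = cmod z / (1 - cmod z)"
  have \<sigma>: "0 \<le> \<sigma>" using z by (simp add: \<sigma>_def)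
  have g0: "g 0 \<in> D" using g(2) by auto
  have "bdist D (g z) / (1 + 2 * \<sigma>) \<le> infdist (g 0) (UNIV - D)"
  proof (rule infdist_greatest[OF bounded_not_univ[OF D(3)]])
    fix q assume "q \<in> UNIV - D"
    hence q: "q \<notin> D" by simp
    obtain a where a: "a \<noteq> 0" "\<And>x. x \<in> D \<Longrightarrow> a \<bullet> x < a \<bullet> q"
      using open_convex_support[OF D(1,2) _ q] g0 by blast
    have gin: "a \<bullet> g w < a \<bullet> q" if "w \<in> ball 0 1" for w using a(2) g(2) that by blast
    from hermitian_form_schwarz[OF g(1) this z]
    have 1: "cmod (hermitian_form a (g z - g 0)) \<le> 2 * (a \<bullet> q - a \<bullet> g 0) * \<sigma>" by (simp add: \<sigma>_def)
    have "a \<bullet> g 0 - a \<bullet> g z \<le> cmod (hermitian_form a (g z - g 0))"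
      using abs_Re_le_cmod[of "hermitian_form a (g z - g 0)"]
      by (simp add: Re_hermitian_form inner_diff_right)
    hence 2: "a \<bullet> q - a \<bullet> g z \<le> (a \<bullet> q - a \<bullet> g 0) * (1 + 2 * \<sigma>)"
      using 1 by (simp add: algebra_simps)
    have "a \<bullet> q - a \<bullet> g 0 \<le> norm a * dist (g 0) q"
      using norm_cauchy_schwarz[of a "q - g 0"] by (simp add: inner_diff_right dist_norm norm_minus_commute)
    hence 3: "a \<bullet> q - a \<bullet> g z \<le> norm a * dist (g 0) q * (1 + 2 * \<sigma>)"
      using 2 \<sigma> by (meson order_trans mult_right_mono add_nonneg_nonneg zero_le_one zero_le_numeral mult_nonneg_nonneg)
    \<comment> \<open>The orthogonal projection of \<open>g z\<close> to the hyperplane through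
      \<open>q\<close>, which misses \<open>D\<close>.\<close>
    define y where "y = g z + ((a \<bullet> q - a \<bullet> g z) / (norm a)\<^sup>2) *\<^sub>R a"
    have "a \<bullet> y = a \<bullet> q"
      using a(1) by (simp add: y_def inner_add_right power2_norm_eq_inner)
    hence "y \<notin> D" using a(2) by fastforce
    hence "bdist D (g z) \<le> dist (g z) y" unfolding bdist_def by (intro infdist_le) simp
    also have "dist (g z) y = (a \<bullet> q - a \<bullet> g z) / norm a"
      using gin[of z] z a(1) by (simp add: y_def dist_norm power2_eq_square)
    also have "\<dots> \<le> dist (g 0) q * (1 + 2 * \<sigma>)" using 3 a(1) by (simp add: field_simps)
    finally show "bdist D (g z) / (1 + 2 * \<sigma>) \<le> dist (g 0) q" using \<sigma> by (simp add: divide_le_eq)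
  qed
  thus ?thesis using \<sigma> by (simp add: bdist_def[symmetric] divide_le_eq \<sigma>_def[symmetric])
qed

text \<open>The functional points along the displacement itself, so its real part there is the whole
  displacement; boundedness places the disc in a half space and replaces convexity.\<close>

lemma disc_displacement_bounded:
  fixes f :: "complex \<Rightarrow> complex^'n"
  assumes f: "holo_disc f" and M: "\<And>w. w \<in> ball 0 1 \<Longrightarrow> dist (f 0) (f w) < M" and z: "cmod z < 1"
  shows "dist (f 0) (f z) \<le> 2 * M * (cmod z / (1 - cmod z))"
proof (cases "f z = f 0")
  case True
  have "0 < M" using M[of 0] by simp
  thus ?thesis using True z by simp
next
  case False
  define a where "a = (f z - f 0) /\<^sub>R norm (f z - f 0)"
  have a: "norm a = 1" using False by (simp add: a_def)
  have "a \<bullet> f w < M + a \<bullet> f 0" if "w \<in> ball 0 1" for w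
    using norm_cauchy_schwarz[of a "f w - f 0"] M[OF that] a
    by (simp add: inner_diff_right dist_norm norm_minus_commute)
  from hermitian_form_schwarz[OF f this z]
  have "cmod (hermitian_form a (f z - f 0)) \<le> 2 * M * (cmod z / (1 - cmod z))" by simp
  moreover have "dist (f 0) (f z) = Re (hermitian_form a (f z - f 0))"
    using False by (simp add: Re_hermitian_form a_def dist_norm norm_minus_commute power2_eq_square
        flip: power2_norm_eq_inner)
  ultimately show ?thesis using complex_Re_le_cmod order_trans by metis
qed

lemma bdist_pos:
  assumes "open D" "bounded D" "x \<in> D"
  shows "0 < bdist D x"
  unfolding bdist_def
  by (rule infdist_pos_not_in_closed) (use assms bounded_not_univ in \<open>auto simp: Compl_eq_Diff_UNIV[symmetric]\<close>)

lemma ball_bdist_subset: "ball x (bdist D x) \<subseteq> D"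
proof
  fix y assume "y \<in> ball x (bdist D x)"
  thus "y \<in> D" unfolding bdist_def using infdist_le[of y "UNIV - D" x] by fastforce
qed

section \<open>Localization of a single disc\<close>

lemma holo_disc_affine: "holo_disc (\<lambda>z. p + z *s v)"
  unfolding holo_disc_def by (auto intro!: holomorphic_intros)

lemma kobayashi_ball_half:
  assumes ball: "ball z \<rho> \<subseteq> D" and y: "dist z y \<le> \<rho> / 2" and \<rho>: "0 < \<rho>"
  shows "kobayashi_dist D z y \<le> 1" "kobayashi_dist D y z \<le> 1"
proof -
  \<comment> \<open>Twice the displacement: \<open>y\<close> is met at parameter 1/2 while the
    affine disc still fits in the ball.\<close>
  define v where "v = (2::complex) *s (y - z)"
  define f where "f = (\<lambda>w::complex. z + w *s v)"
  have v: "norm v \<le> \<rho>" unfolding v_def norm_scale_vec using y by (simp add: dist_norm norm_minus_commute)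
  have "f w \<in> D" if "cmod w < 1" for w
  proof -
    have "cmod w * norm v \<le> cmod w * \<rho>" using v by (intro mult_left_mono) auto
    also have "\<dots> < \<rho>" using that \<rho> by simp
    finally show ?thesis by (intro subsetD[OF ball]) (simp add: f_def dist_norm norm_scale_vec)
  qed
  hence f: "f ` ball 0 1 \<subseteq> D" by auto
  have h: "holo_disc f" unfolding f_def by (rule holo_disc_affine)
  have f0: "f 0 = z" "f (1/2) = y" by (simp_all add: f_def v_def)
  have a: "artanh (1/2::real) \<le> 1" using artanh_le[of "1/2"] by simp
  hence p: "poincare_dist 0 (1/2) \<le> 1" "poincare_dist (1/2) 0 \<le> 1"
    by (simp_all add: poincare_dist_def norm_divide)
  have "hstep D z y (poincare_dist 0 (1/2))" "hstep D y z (poincare_dist (1/2) 0)"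
    using hstep_of_disc[OF h f, of 0 "1/2"] hstep_of_disc[OF h f, of "1/2" 0] by (simp_all add: f0 norm_divide)
  from this[THEN kobayashi_le_hstep] p
  show "kobayashi_dist D z y \<le> 1" "kobayashi_dist D y z \<le> 1"
    by (auto elim!: order_trans simp: one_ereal_def)
qed

section \<open>A logarithmic upper bound for the distance in convex domains\<close>

lemma convex_contract_ball:
  fixes D :: "'a::real_normed_vector set"
  assumes "convex D" "x \<in> D" "ball p c \<subseteq> D" "0 < t" "t \<le> 1"
  shows "ball (x + t *\<^sub>R (p - x)) (t * c) \<subseteq> D"
proof
  fix y assume y: "y \<in> ball (x + t *\<^sub>R (p - x)) (t * c)"
  define e where "e = y - (x + t *\<^sub>R (p - x))"
  define w where "w = p + (1 / t) *\<^sub>R e"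
  have "norm e < t * c" using y by (simp add: e_def dist_norm norm_minus_commute)
  hence "dist p w < c" using assms(4) by (simp add: w_def dist_norm divide_less_eq mult.commute)
  hence "w \<in> D" using assms(3) by auto
  hence "(1 - t) *\<^sub>R x + t *\<^sub>R w \<in> D" using assms by (intro convexD) auto
  moreover have "(1 - t) *\<^sub>R x + t *\<^sub>R w = y" using assms(4) by (simp add: w_def e_def algebra_simps)
  ultimately show "y \<in> D" by simp
qed

text \<open>By homothety the point of parameter \<open>t\<close> on the segment from
  \<open>x\<close> to \<open>p\<close> carries a ball of radius \<open>t * c\<close>. Multiplying
  \<open>t\<close> by a fixed factor \<open>lam\<close> thus costs at most 1, and about
  \<open>ln (1 / t) / ln lam\<close> such moves reach \<open>p\<close>. A first move inside the ball
  of radius \<open>bdist D x\<close> about \<open>x\<close> makes the initial \<open>t\<close>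
  proportional to that height.\<close>

lemma convex_kobayashi_upper:
  assumes "0 < c" "0 < M"
  shows "\<exists>A B. 0 < A \<and> 0 < B \<and> (\<forall>(D :: (complex^'n) set) p x y. open D \<longrightarrow> bounded D \<longrightarrow> convex D \<longrightarrow> ball p c \<subseteq> D \<longrightarrow>
     (\<forall>z\<in>D. dist p z \<le> M) \<longrightarrow> x \<in> D \<longrightarrow> y \<in> D \<longrightarrow>
     kobayashi_dist D x y \<le> ereal (B - A * ln (bdist D x) - A * ln (bdist D y)))"
proof -
  \<comment> \<open>Passing from \<open>t\<close> to \<open>t * lam\<close> moves the point by at
    most \<open>t * c / 2\<close>, half the radius available at parameter \<open>t\<close>.\<close>
  define lam where "lam = 1 + c / (2 * M)"
  have lam: "1 < lam" using assms by (simp add: lam_def)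
  define A where "A = 1 / ln lam"
  have A: "0 < A" using lam by (simp add: A_def)
  define M1 where "M1 = 2 * M + 1"
  define Z where "Z = A * \<bar>ln (2 * M1)\<bar>"
  have Z: "0 \<le> Z" using A by (simp add: Z_def)
  define B where "B = 4 + 2 * Z"
  have "kobayashi_dist D x y \<le> ereal (B - A * ln (bdist D x) - A * ln (bdist D y))"
    if D: "open D" "bounded D" "convex D" and p: "ball p c \<subseteq> D" and dia: "\<forall>z\<in>D. dist p z \<le> M"
      and xy: "x \<in> D" "y \<in> D" for D :: "(complex^'n) set" and p x y
  proof -
    have pD: "p \<in> D" using p assms by auto
    have main: "kobayashi_dist D x p \<le> ereal (B / 2 - A * ln (bdist D x)) \<and>
                kobayashi_dist D p x \<le> ereal (B / 2 - A * ln (bdist D x))"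
      if x: "x \<in> D" for x
    proof -
      define w where "w t = x + t *\<^sub>R (p - x)" for t
      define u where "u = bdist D x"
      have u: "0 < u" unfolding u_def by (rule bdist_pos[OF D(1,2) x])
      have w_in: "w t \<in> D" if "0 < t" "t \<le> 1" for t
        using convex_contract_ball[OF D(3) x p that] assms that by (auto simp: w_def)
      have dw: "dist (w s) (w t) \<le> \<bar>s - t\<bar> * M" for s t
      proof -
        have "w s - w t = (s - t) *\<^sub>R (p - x)" by (simp add: w_def algebra_simps)
        thus ?thesis using dia x by (simp add: dist_norm mult_left_mono)
      qed
      have climb: "0 < t \<Longrightarrow> t \<le> 1 \<Longrightarrow> 1 \<le> t * lam ^ k \<Longrightarrow>
         kobayashi_dist D (w t) p \<le> ereal (real k) \<and> kobayashi_dist D p (w t) \<le> ereal (real k)" for t k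
      proof (induction k arbitrary: t)
        case 0
        hence "w t = p" by (simp add: w_def)
        thus ?case using kobayashi_refl_le[OF pD] by (simp add: zero_ereal_def)
      next
        case (Suc k)
        \<comment> \<open>Capping at 1 keeps the last move from overshooting
          \<open>p\<close>.\<close>
        define t' where "t' = min 1 (t * lam)"
        have t': "0 < t'" "t' \<le> 1" "t \<le> t'" using Suc.prems lam
          by (auto simp: t'_def)
        have "1 \<le> lam ^ k" using lam by simp
        hence "1 \<le> t' * lam ^ k" using Suc.prems(3) by (simp add: t'_def min_def mult.assoc)
        from Suc.IH[OF t'(1,2) this]
        have IH: "kobayashi_dist D (w t') p \<le> ereal (real k)" "kobayashi_dist D p (w t') \<le> ereal (real k)" by auto
        have "t' - t \<le> t * (c / (2 * M))" by (simp add: t'_def lam_def algebra_simps min_def)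
        hence "(t' - t) * M \<le> t * (c / (2 * M)) * M" using assms by (intro mult_right_mono) auto
        hence "dist (w t) (w t') \<le> t * c / 2"
          using dw[of t t'] t'(3) assms by simp
        moreover have "ball (w t) (t * c) \<subseteq> D"
          unfolding w_def by (rule convex_contract_ball[OF D(3) x p Suc.prems(1,2)])
        ultimately have "kobayashi_dist D (w t) (w t') \<le> ereal 1" "kobayashi_dist D (w t') (w t) \<le> ereal 1"
          using kobayashi_ball_half[of "w t" "t * c" D "w t'"] Suc.prems assms by (auto simp: one_ereal_def)
        thus ?case
          using kobayashi_triangle[OF _ IH(1) pD, of "w t" 1]
            kobayashi_triangle[OF IH(2) _ w_in[OF Suc.prems(1,2)], of 1] by (simp add: add.commute)
      qed
      \<comment> \<open>Some \<open>q\<close> at distance \<open>M + 1\<close> from \<open>p\<close>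
        lies outside \<open>D\<close> and within \<open>M1\<close> of \<open>x\<close>, so the
        height cannot exceed \<open>M1\<close>; this gives \<open>t \<le> 1\<close> below.\<close>
      have u_le: "u \<le> M1"
      proof (rule ccontr)
        assume n: "\<not> u \<le> M1"
        obtain q where q: "q \<notin> D" "dist p q = M + 1"
        proof -
          obtain e :: "complex^'n" where "norm e = M + 1" using vector_choose_size[of "M + 1"] assms by auto
          thus thesis using that[of "p + e"] dia by (force simp: dist_norm)
        qed
        have "dist x q \<le> M1" using q dia x dist_triangle[of x q p] by (fastforce simp: M1_def dist_commute)
        hence "q \<in> D" using n ball_bdist_subset[of x D] by (auto simp: u_def)
        thus False using q by simp
      qed
      define t where "t = u / (2 * M1)"
      have M1: "0 < M1" "M \<le> M1" using assms by (auto simp: M1_def)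
      have t: "0 < t" "t \<le> 1" using u u_le M1 by (auto simp: t_def)
      have "t * M \<le> t * M1" using t M1 by simp
      also have "\<dots> = u / 2" using M1 by (simp add: t_def)
      finally have "dist x (w t) \<le> u / 2" using dw[of 0 t] t by (simp add: w_def)
      hence s: "kobayashi_dist D x (w t) \<le> ereal 1" "kobayashi_dist D (w t) x \<le> ereal 1"
        using kobayashi_ball_half[OF ball_bdist_subset[of x D], of "w t"] u
        by (auto simp: u_def one_ereal_def)
      define k where "k = nat \<lceil>A * ln (1 / t)\<rceil>"
      have lt: "0 \<le> ln (1 / t)" using t by simp
      have k: "A * ln (1 / t) \<le> real k" "real k \<le> A * ln (1 / t) + 1"
        using lt A unfolding k_def by (auto simp: of_nat_ceiling less_imp_le intro: real_nat_ceiling_ge)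
      have "ln (1 / t) \<le> real k * ln lam" using k(1) lam by (simp add: A_def field_simps)
      also have "\<dots> = ln (lam ^ k)" using lam by (simp add: ln_realpow)
      finally have "1 / t \<le> lam ^ k" using t lam by (subst (asm) ln_le_cancel_iff) auto
      hence "1 \<le> t * lam ^ k" using t by (simp add: field_simps)
      from climb[OF t this] have cl: "kobayashi_dist D (w t) p \<le> ereal (real k)" "kobayashi_dist D p (w t) \<le> ereal (real k)" by auto
      have "ln (1 / t) = ln (2 * M1) - ln u" using u M1 by (simp add: t_def ln_div)
      hence "A * ln (1 / t) = A * ln (2 * M1) - A * ln u" by (simp only: right_diff_distrib)
      also have "\<dots> \<le> Z - A * ln u" using A by (simp add: Z_def)
      finally have "A * ln (1 / t) + 1 \<le> Z - A * ln u + 1" by simp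
      with k(2) have "real k \<le> Z - A * ln u + 1" by (rule order_trans)
      hence b: "1 + real k \<le> B / 2 - A * ln u" by (simp add: B_def add_divide_distrib)
      have "kobayashi_dist D x p \<le> ereal (1 + real k)" "kobayashi_dist D p x \<le> ereal (real k + 1)"
        by (rule kobayashi_triangle[OF s(1) cl(1) pD]) (rule kobayashi_triangle[OF cl(2) s(2) x])
      thus ?thesis using b unfolding u_def by (auto elim!: order_trans)
    qed
    from kobayashi_triangle[OF main[OF xy(1), THEN conjunct1] main[OF xy(2), THEN conjunct2] xy(2)]
    show ?thesis by (simp add: algebra_simps)
  qed
  moreover have "0 < B" using Z by (simp add: B_def)
  ultimately show ?thesis using A by blast
qed

text \<open>What the metric argument takes from the atlas, with constants independent of
  \<open>\<xi>\<close>. In the application \<open>\<Xi>\<close> is the frontier, \<open>b\<close> is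
  \<open>1 / L\<close>, and \<open>c\<close> is the radius of a ball inside every convex model;
  finite type acts through \<open>model_dir\<close>.\<close>

locale uniform_atlas =
  fixes \<Omega> :: "(complex^'n) set" and \<Xi> :: "(complex^'n) set"
    and V :: "complex^'n \<Rightarrow> (complex^'n) set"
    and \<Phi> \<Psi> :: "complex^'n \<Rightarrow> complex^'n \<Rightarrow> complex^'n"
    and C \<tau> M b c :: real
  assumes C_pos: "0 < C" and \<tau>_pos: "0 < \<tau>" and M_pos: "0 < M" and b_pos: "0 < b" and c_pos: "0 < c"
    and diam: "x \<in> \<Omega> \<Longrightarrow> y \<in> \<Omega> \<Longrightarrow> dist x y < M"
    and ball_V: "\<xi> \<in> \<Xi> \<Longrightarrow> ball \<xi> \<tau> \<subseteq> V \<xi>"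
    and \<Phi>_holo: "\<xi> \<in> \<Xi> \<Longrightarrow> cholo_on (\<Phi> \<xi>) (V \<xi>)"
    and \<Psi>_holo: "\<xi> \<in> \<Xi> \<Longrightarrow> cholo_on (\<Psi> \<xi>) (\<Phi> \<xi> ` V \<xi>)"
    and \<Psi>_\<Phi>: "\<xi> \<in> \<Xi> \<Longrightarrow> x \<in> V \<xi> \<Longrightarrow> \<Psi> \<xi> (\<Phi> \<xi> x) = x"
    and model_open: "\<xi> \<in> \<Xi> \<Longrightarrow> open (\<Phi> \<xi> ` (V \<xi> \<inter> \<Omega>))"
    and model_convex: "\<xi> \<in> \<Xi> \<Longrightarrow> convex (\<Phi> \<xi> ` (V \<xi> \<inter> \<Omega>))"
    and model_ball: "\<xi> \<in> \<Xi> \<Longrightarrow> \<exists>p. ball p c \<subseteq> \<Phi> \<xi> ` (V \<xi> \<inter> \<Omega>)"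
    and model_dir: "\<xi> \<in> \<Xi> \<Longrightarrow> p \<in> \<Phi> \<xi> ` (V \<xi> \<inter> \<Omega>) \<Longrightarrow> v \<noteq> 0 \<Longrightarrow>
       bdist_dir (\<Phi> \<xi> ` (V \<xi> \<inter> \<Omega>)) p v \<le> C * bdist (\<Phi> \<xi> ` (V \<xi> \<inter> \<Omega>)) p powr b"
    and \<Phi>_lower: "\<xi> \<in> \<Xi> \<Longrightarrow> x \<in> V \<xi> \<Longrightarrow> y \<in> V \<xi> \<Longrightarrow> norm (x - y) \<le> C * norm (\<Phi> \<xi> x - \<Phi> \<xi> y)"
    and \<Phi>_upper: "\<xi> \<in> \<Xi> \<Longrightarrow> x \<in> V \<xi> \<Longrightarrow> y \<in> V \<xi> \<Longrightarrow> norm (\<Phi> \<xi> x - \<Phi> \<xi> y) \<le> C * norm (x - y)"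
begin

definition model :: "complex^'n \<Rightarrow> (complex^'n) set" where
  "model \<xi> = \<Phi> \<xi> ` (V \<xi> \<inter> \<Omega>)"

definition height :: "complex^'n \<Rightarrow> complex^'n \<Rightarrow> real" where
  "height \<xi> x = bdist (model \<xi>) (\<Phi> \<xi> x)"

text \<open>The subdisc of radius \<open>r0\<close> of any disc in \<open>\<Omega>\<close> centred within \<open>\<tau> / 2\<close> of \<open>\<xi>\<close> stays in the chart.\<close>

definition r0 :: real where "r0 = min (1/2) (\<tau> / (8 * M))"

text \<open>One constant above three: \<open>4 * C\<^sup>2 / r0\<close> for speed in terms of
  height, \<open>4 / r0\<close> for growth of the height, and \<open>4 * M\<close> for the crude
  speed.\<close>

definition K1 :: real where "K1 = 4 * (C\<^sup>2 + 1) / r0 + 4 * M"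

lemma r0: "0 < r0" "r0 \<le> 1/2" "4 * M * r0 \<le> \<tau> / 2"
proof -
  show "0 < r0" "r0 \<le> 1/2" using \<tau>_pos M_pos by (auto simp: r0_def)
  have "r0 \<le> \<tau> / (8 * M)" by (simp add: r0_def)
  thus "4 * M * r0 \<le> \<tau> / 2" using M_pos by (simp add: field_simps)
qed

lemma K1_pos: "0 < K1" and K1_ge: "4 * C\<^sup>2 / r0 \<le> K1" "4 / r0 \<le> K1" "4 * M \<le> K1"
  unfolding K1_def using r0(1) M_pos by (auto simp: add_divide_distrib distrib_left intro!: add_nonneg_pos)

lemma model_dist: "\<xi> \<in> \<Xi> \<Longrightarrow> p \<in> model \<xi> \<Longrightarrow> q \<in> model \<xi> \<Longrightarrow> dist p q \<le> C * M"
proof -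
  assume a: "\<xi> \<in> \<Xi>" "p \<in> model \<xi>" "q \<in> model \<xi>"
  then obtain x y where xy: "x \<in> V \<xi> \<inter> \<Omega>" "y \<in> V \<xi> \<inter> \<Omega>" "p = \<Phi> \<xi> x" "q = \<Phi> \<xi> y"
    by (auto simp: model_def)
  have "dist p q \<le> C * dist x y" using \<Phi>_upper[OF a(1)] xy by (simp add: dist_norm)
  also have "\<dots> \<le> C * M" using diam[of x y] xy C_pos by simp
  finally show ?thesis .
qed

lemma model_bounded: "\<xi> \<in> \<Xi> \<Longrightarrow> bounded (model \<xi>)"
  unfolding bounded_def using model_dist by (cases "model \<xi> = {}") blast+

lemma height_pos: "\<xi> \<in> \<Xi> \<Longrightarrow> x \<in> V \<xi> \<inter> \<Omega> \<Longrightarrow> 0 < height \<xi> x"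
  unfolding height_def
  by (rule bdist_pos) (use model_open model_bounded in \<open>auto simp: model_def\<close>)

text \<open>The inverse chart is a holomorphic map of the convex model into
  \<open>\<Omega> \<inter> V \<xi>\<close>, so the bound for convex domains descends;
  \<open>C * M\<close> bounds the diameter of every model, which makes \<open>A\<close> and
  \<open>B\<close> uniform.\<close>

lemma kobayashi_local_upper:
  "\<exists>A B. 0 < A \<and> 0 < B \<and> (\<forall>\<xi>\<in>\<Xi>. \<forall>x\<in>V \<xi> \<inter> \<Omega>. \<forall>y\<in>V \<xi> \<inter> \<Omega>.
     kobayashi_dist (\<Omega> \<inter> V \<xi>) x y \<le> ereal (B - A * ln (height \<xi> x) - A * ln (height \<xi> y)))"
proof -
  have "0 < C * M" using C_pos M_pos by simp
  from convex_kobayashi_upper[OF c_pos this, where 'n='n]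
  obtain A B where AB: "0 < A" "0 < B" and
    K: "\<And>(D :: (complex^'n) set) p x y. open D \<Longrightarrow> bounded D \<Longrightarrow> convex D \<Longrightarrow> ball p c \<subseteq> D \<Longrightarrow>
     (\<forall>z\<in>D. dist p z \<le> C * M) \<Longrightarrow> x \<in> D \<Longrightarrow> y \<in> D \<Longrightarrow>
     kobayashi_dist D x y \<le> ereal (B - A * ln (bdist D x) - A * ln (bdist D y))" by blast
  have "kobayashi_dist (\<Omega> \<inter> V \<xi>) x y \<le> ereal (B - A * ln (height \<xi> x) - A * ln (height \<xi> y))"
    if \<xi>: "\<xi> \<in> \<Xi>" and x: "x \<in> V \<xi> \<inter> \<Omega>" and y: "y \<in> V \<xi> \<inter> \<Omega>" for \<xi> x y
  proof -
    obtain p where p: "ball p c \<subseteq> model \<xi>" using model_ball[OF \<xi>] by (auto simp: model_def)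
    have pm: "p \<in> model \<xi>" using p c_pos by auto
    have "cholo_on (\<Psi> \<xi>) (model \<xi>)"
      using \<Psi>_holo[OF \<xi>] unfolding cholo_on_def model_def by blast
    moreover have "\<Psi> \<xi> ` model \<xi> \<subseteq> \<Omega> \<inter> V \<xi>" using \<Psi>_\<Phi>[OF \<xi>] by (auto simp: model_def)
    ultimately have "kobayashi_dist (\<Omega> \<inter> V \<xi>) (\<Psi> \<xi> (\<Phi> \<xi> x)) (\<Psi> \<xi> (\<Phi> \<xi> y)) \<le>
        kobayashi_dist (model \<xi>) (\<Phi> \<xi> x) (\<Phi> \<xi> y)" by (rule kobayashi_contract)
    also have "\<dots> \<le> ereal (B - A * ln (height \<xi> x) - A * ln (height \<xi> y))"
      unfolding height_def
      by (rule K[OF _ model_bounded[OF \<xi>] _ p])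
         (use model_open[OF \<xi>] model_convex[OF \<xi>] model_dist[OF \<xi> pm] x y in \<open>auto simp: model_def\<close>)
    finally show ?thesis using \<Psi>_\<Phi>[OF \<xi>] x y by simp
  qed
  thus ?thesis using AB by blast
qed

lemma disc_displacement:
  assumes "holo_disc f" "f ` ball 0 1 \<subseteq> \<Omega>" "cmod z < r0"
  shows "dist (f 0) (f z) \<le> 4 * M * cmod z"
proof -
  have z: "cmod z < 1" using assms(3) r0 by simp
  have "cmod z * 1 \<le> cmod z * (2 * (1 - cmod z))"
    using assms(3) r0 by (intro mult_left_mono) auto
  hence z2: "cmod z / (1 - cmod z) \<le> 2 * cmod z" using z by (simp add: divide_le_eq mult_ac)
  have "dist (f 0) (f w) < M" if "w \<in> ball 0 1" for w
    using assms(2) that by (intro diam) auto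
  from disc_displacement_bounded[OF assms(1) this z]
  have "dist (f 0) (f z) \<le> 2 * M * (cmod z / (1 - cmod z))" .
  also have "\<dots> \<le> 2 * M * (2 * cmod z)" using z2 M_pos by (intro mult_left_mono) auto
  finally show ?thesis by simp
qed

lemma disc_stays_local:
  assumes "f 0 \<in> ball \<xi> (\<tau>/2)" "holo_disc f" "f ` ball 0 1 \<subseteq> \<Omega>" "cmod z < r0"
  shows "f z \<in> ball \<xi> \<tau>"
proof -
  have "dist (f 0) (f z) \<le> 4 * M * cmod z" by (rule disc_displacement[OF assms(2-4)])
  also have "\<dots> \<le> 4 * M * r0" using assms(4) M_pos by simp
  also have "\<dots> \<le> \<tau> / 2" by (rule r0)
  finally show "f z \<in> ball \<xi> \<tau>" using assms(1) dist_triangle[of \<xi> "f z" "f 0"] by auto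
qed

text \<open>Holds wherever \<open>x\<close> lies; it will control the step that re-enters the ball,
  whose starting point is outside.\<close>

lemma step_displacement:
  assumes st: "hstep \<Omega> x y l" and l: "l \<le> r0 / 2"
  shows "dist x y \<le> K1 * l"
proof -
  obtain f where f: "holo_disc f" "f ` ball 0 1 \<subseteq> \<Omega>" "f 0 = x" "f (of_real (tanh l)) = y" and l0: "0 \<le> l"
    using st unfolding hstep_def by blast
  have s: "0 \<le> tanh l" "tanh l \<le> l" "tanh l < r0"
    using l0 l tanh_le_self[OF l0] r0 by auto
  have "dist x y \<le> 4 * M * tanh l"
    using disc_displacement[OF f(1,2), of "of_real (tanh l)"] f(3,4) s by simp
  also have "\<dots> \<le> K1 * l" using K1_ge(3) s M_pos by (intro mult_mono) (auto intro: less_imp_le K1_pos)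
  finally show ?thesis .
qed

text \<open>The subdisc of radius \<open>r0\<close> is rescaled to the unit disc and mapped to the
  model, where the estimates for convex domains apply at \<open>\<sigma> = tanh l / r0\<close>. The
  bound on \<open>l\<close> gives \<open>\<sigma> \<le> 1/2\<close>, hence estimates linear in
  \<open>l\<close>. \<open>model_dir\<close> converts the directional distance into a power of the
  height, and \<open>\<Phi>_lower\<close> brings the displacement back to
  \<open>\<Omega>\<close>.\<close>

lemma step_estimates:
  assumes \<xi>: "\<xi> \<in> \<Xi>" and x: "x \<in> ball \<xi> (\<tau>/2)" and st: "hstep \<Omega> x y l" and l: "l \<le> r0 / 2"
  shows "x \<in> V \<xi> \<inter> \<Omega>" "y \<in> V \<xi> \<inter> \<Omega>" "dist x y \<le> K1 * height \<xi> x powr b * l"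
    "height \<xi> y \<le> height \<xi> x * (1 + K1 * l)"
proof -
  obtain f where f: "holo_disc f" "f ` ball 0 1 \<subseteq> \<Omega>" "f 0 = x" "f (of_real (tanh l)) = y" and l0: "0 \<le> l"
    using st unfolding hstep_def by blast
  define s where "s = tanh l"
  have s: "0 \<le> s" "s \<le> l" "s \<le> r0 / 2" "s < r0"
    using l0 l tanh_le_self[OF l0] r0 by (auto simp: s_def)
  have loc: "f z \<in> ball \<xi> \<tau>" if "cmod z < r0" for z
    using disc_stays_local[OF _ f(1,2) that] x f(3) by simp
  show xV: "x \<in> V \<xi> \<inter> \<Omega>" using loc[of 0] ball_V[OF \<xi>] f r0 by force
  have "y \<in> \<Omega>" using f(2,4) tanh_in_ball[of l] by blast
  thus yV: "y \<in> V \<xi> \<inter> \<Omega>" using loc[of "of_real s"] ball_V[OF \<xi>] f(4) s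
    by (auto simp: s_def simp del: mem_ball)
  define g where "g z = \<Phi> \<xi> (f (of_real r0 * z))" for z
  have rm: "(\<lambda>z. of_real r0 * z) ` ball 0 1 \<subseteq> ball (0::complex) r0"
    using r0(1) by (auto simp: norm_mult)
  have rm1: "(\<lambda>z. of_real r0 * z) ` ball 0 1 \<subseteq> ball (0::complex) 1"
    using rm r0 by force
  have h1: "holo_disc (\<lambda>z. f (of_real r0 * z))"
    by (rule holo_disc_compose[OF f(1) _ rm1]) (intro holomorphic_intros)
  have im: "(\<lambda>z. f (of_real r0 * z)) ` ball 0 1 \<subseteq> V \<xi> \<inter> \<Omega>"
  proof
    fix w assume "w \<in> (\<lambda>z. f (of_real r0 * z)) ` ball 0 1"
    then obtain z where z: "z \<in> ball 0 1" "w = f (of_real r0 * z)" by blast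
    have "w \<in> ball \<xi> \<tau>" unfolding z(2) using r0(1) z(1) by (intro loc) (simp add: norm_mult)
    moreover have "w \<in> \<Omega>" unfolding z(2) using rm1 z(1) f(2) by blast
    ultimately show "w \<in> V \<xi> \<inter> \<Omega>" using ball_V[OF \<xi>] by blast
  qed
  have g: "holo_disc g" unfolding g_def[abs_def]
    by (rule holo_disc_cholo[OF h1, where S="V \<xi>"]) (use im \<Phi>_holo[OF \<xi>] in auto)
  have gD: "g ` ball 0 1 \<subseteq> model \<xi>" using im by (auto simp: g_def model_def)
  define \<sigma> where "\<sigma> = s / r0"
  have \<sigma>: "0 \<le> \<sigma>" "\<sigma> \<le> 1/2" using s r0 by (auto simp: \<sigma>_def field_simps)
  have c\<sigma>: "cmod (of_real \<sigma>) = \<sigma>" "cmod (of_real \<sigma>) < 1" using \<sigma> by auto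
  have g0: "g 0 = \<Phi> \<xi> x" "g (of_real \<sigma>) = \<Phi> \<xi> y"
    using f(3,4) r0(1) by (auto simp: g_def \<sigma>_def s_def)
  have "\<sigma> * 1 \<le> \<sigma> * (2 * (1 - \<sigma>))" using \<sigma> by (intro mult_left_mono) auto
  hence "\<sigma> / (1 - \<sigma>) \<le> 2 * \<sigma>" using \<sigma> by (simp add: divide_le_eq mult_ac)
  also have "\<dots> \<le> 2 * (l / r0)" using s r0 by (simp add: \<sigma>_def divide_right_mono)
  finally have \<sigma>l: "2 * (\<sigma> / (1 - \<sigma>)) \<le> 4 / r0 * l" by simp
  note D = model_open[OF \<xi>, folded model_def] model_convex[OF \<xi>, folded model_def] model_bounded[OF \<xi>]
  show "dist x y \<le> K1 * height \<xi> x powr b * l"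
  proof (cases "\<Phi> \<xi> y = \<Phi> \<xi> x")
    case True
    hence "x = y" using \<Psi>_\<Phi>[OF \<xi>] xV yV by (metis IntD1)
    thus ?thesis using K1_pos l0 by simp
  next
    case False
    let ?v = "\<Phi> \<xi> y - \<Phi> \<xi> x"
    have "norm ?v \<le> bdist_dir (model \<xi>) (\<Phi> \<xi> x) ?v * (2 * (\<sigma> / (1 - \<sigma>)))"
      using convex_disc_displacement[OF D g gD c\<sigma>(2)] False \<sigma>(1) by (simp add: g0)
    also have "\<dots> \<le> (C * height \<xi> x powr b) * (4 / r0 * l)"
      using model_dir[OF \<xi>, of "\<Phi> \<xi> x" ?v] False xV \<sigma> C_pos
      by (intro mult_mono \<sigma>l) (auto simp: height_def model_def)
    finally have v: "norm ?v \<le> (C * height \<xi> x powr b) * (4 / r0 * l)" .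
    have "dist x y \<le> C * norm ?v" using \<Phi>_lower[OF \<xi>, of x y] xV yV by (simp add: dist_norm norm_minus_commute)
    also have "\<dots> \<le> C * ((C * height \<xi> x powr b) * (4 / r0 * l))" by (rule mult_left_mono[OF v]) (use C_pos in simp)
    also have "\<dots> = (4 * C\<^sup>2 / r0) * (height \<xi> x powr b * l)" by (simp add: power2_eq_square)
    also have "\<dots> \<le> K1 * (height \<xi> x powr b * l)" using K1_ge(1) l0 by (intro mult_right_mono) auto
    finally show ?thesis by simp
  qed
  have h0: "0 \<le> height \<xi> x" using height_pos[OF \<xi> xV] by simp
  have "height \<xi> y \<le> height \<xi> x * (1 + 2 * (\<sigma> / (1 - \<sigma>)))"
    using convex_disc_bdist[OF D g gD c\<sigma>(2)] \<sigma>(1) by (simp add: g0 height_def)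
  also have "2 * (\<sigma> / (1 - \<sigma>)) \<le> K1 * l"
    using \<sigma>l K1_ge(2) l0 by (meson mult_right_mono order_trans)
  finally show "height \<xi> y \<le> height \<xi> x * (1 + K1 * l)" using h0 by (simp add: mult_left_mono)
qed

end

section \<open>Sums along chains\<close>

lemma hpath_nonneg: "hpath \<Omega> \<eta> x l N \<Longrightarrow> k < N \<Longrightarrow> 0 \<le> l k"
  unfolding hpath_def hstep_def by blast

lemma dist_sum_steps:
  fixes x :: "nat \<Rightarrow> 'a::metric_space"
  assumes "m \<le> k" "\<And>j. m \<le> j \<Longrightarrow> j < k \<Longrightarrow> dist (x j) (x (Suc j)) \<le> d j"
  shows "dist (x m) (x k) \<le> (\<Sum>j=m..<k. d j)"
  using assms
proof (induction k rule: dec_induct)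
  case (step k)
  have "dist (x m) (x k) \<le> (\<Sum>j=m..<k. d j)" by (rule step.IH) (use step in auto)
  thus ?case using step.prems[of k] step.hyps dist_triangle[of "x m" "x (Suc k)" "x k"] by simp
qed simp

lemma exp_neg_le_half:
  fixes y :: real
  assumes "0 \<le> y" "y \<le> 1"
  shows "y \<le> 2 * (1 - exp (- y))"
proof -
  have "exp (- y) \<le> 1 / (1 + y)"
    using exp_ge_add_one_self[of y] assms by (simp add: exp_minus divide_simps)
  also have "\<dots> \<le> 1 - y / 2"
  proof -
    have "y * y \<le> y * 1" using assms by (intro mult_left_mono) auto
    hence "1 \<le> (1 - y / 2) * (1 + y)" by (simp add: algebra_simps)
    thus ?thesis using assms by (simp add: divide_le_eq)
  qed
  finally show ?thesis by simp
qed

text \<open>A Riemann sum for the integral of \<open>exp (- c * \<bar>t - s\<bar>)\<close>, bounded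
  by telescoping an antiderivative. The integral is at most \<open>2 / c\<close>; steps of scaled
  length at most 1 cost a further factor 2.\<close>

lemma sum_exp_abs_le:
  fixes t l :: "nat \<Rightarrow> real"
  assumes "m \<le> k" "0 < c"
    "\<And>j. m \<le> j \<Longrightarrow> j < k \<Longrightarrow> 0 \<le> l j \<and> c * l j \<le> 1 \<and> t (Suc j) = t j + l j"
  shows "(\<Sum>j=m..<k. l j * exp (- c * \<bar>t j - s\<bar>)) \<le> 4 / c"
proof -
  \<comment> \<open>The antiderivative of \<open>exp (- \<bar>z\<bar>)\<close> that vanishes at
    minus infinity and tends to 2 at infinity.\<close>
  define P :: "real \<Rightarrow> real" where "P z = (if z \<le> 0 then exp z else 2 - exp (- z))" for z
  have P: "0 \<le> P z" "P z \<le> 2" for z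
    unfolding P_def using exp_le_one_iff[of z] exp_le_one_iff[of "- z"] exp_gt_zero[of z]
      exp_gt_zero[of "- z"] by (smt (verit))+
  have inc: "y * exp (- \<bar>z\<bar>) \<le> 2 * (P (z + y) - P z)" if y: "0 \<le> y" "y \<le> 1" for y z :: real
  proof -
    consider "0 < z" | "z + y \<le> 0" | "z \<le> 0" "0 < z + y" by linarith
    thus ?thesis
    proof cases
      case 1
      have "y * exp (- z) \<le> 2 * (1 - exp (- y)) * exp (- z)"
        using exp_neg_le_half[OF y] by (intro mult_right_mono) auto
      also have "\<dots> = 2 * (exp (- z) - exp (- (z + y)))"
        by (simp add: exp_diff exp_minus field_simps)
      also have "\<dots> = 2 * (P (z + y) - P z)"
        using 1 y by (simp add: P_def)
      finally show ?thesis using 1 by simp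
    next
      case 2
      have "y * exp z \<le> (exp y - 1) * exp z"
        using exp_ge_add_one_self[of y] by (intro mult_right_mono) (linarith, simp)
      also have "\<dots> = P (z + y) - P z" using 2 y by (simp add: P_def exp_add algebra_simps)
      finally have le: "y * exp (- \<bar>z\<bar>) \<le> P (z + y) - P z" using 2 y by simp
      moreover have "0 \<le> y * exp (- \<bar>z\<bar>)" using y by simp
      from order_trans[OF this le] have "P (z + y) - P z \<le> 2 * (P (z + y) - P z)" by simp
      ultimately show ?thesis by (rule order_trans)
    next
      case 3
      have "z + y \<le> 2 * (1 - exp (- (z + y)))" using 3 y by (intro exp_neg_le_half) auto
      moreover have "- z \<le> 2 * (1 - exp (- (- z)))" using 3 y by (intro exp_neg_le_half) auto
      ultimately have "y \<le> 2 * (P (z + y) - P z)" using 3 by (simp add: P_def)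
      moreover have "y * exp (- \<bar>z\<bar>) \<le> y * 1" using y by (intro mult_left_mono) auto
      ultimately show ?thesis by simp
    qed
  qed
  have "(\<Sum>j=m..<k. l j * exp (- c * \<bar>t j - s\<bar>)) \<le> (\<Sum>j=m..<k. 2 / c * (P (c * (t (Suc j) - s)) - P (c * (t j - s))))"
  proof (rule sum_mono)
    fix j assume "j \<in> {m..<k}"
    hence j: "0 \<le> l j" "c * l j \<le> 1" "t (Suc j) = t j + l j" using assms(3) by auto
    have "(c * l j) * exp (- \<bar>c * (t j - s)\<bar>) \<le> 2 * (P (c * (t j - s) + c * l j) - P (c * (t j - s)))"
      using j assms(2) by (intro inc) auto
    moreover have "c * (t j - s) + c * l j = c * (t (Suc j) - s)" using j(3) by (simp add: algebra_simps)
    moreover have "\<bar>c * (t j - s)\<bar> = c * \<bar>t j - s\<bar>" using assms(2) by (simp add: abs_mult)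
    ultimately show "l j * exp (- c * \<bar>t j - s\<bar>) \<le> 2 / c * (P (c * (t (Suc j) - s)) - P (c * (t j - s)))"
      using assms(2) by (simp add: pos_le_divide_eq mult_ac)
  qed
  also have "\<dots> = 2 / c * (P (c * (t k - s)) - P (c * (t m - s)))"
    by (simp only: sum_distrib_left[symmetric] sum_Suc_diff'[OF assms(1), of "\<lambda>j. P (c * (t j - s))"])
  also have "\<dots> \<le> 2 / c * 2" using P[of "c * (t k - s)"] P[of "c * (t m - s)"] assms(2)
    by (intro mult_left_mono) auto
  finally show ?thesis by simp
qed

section \<open>Exit from the chart and the local cost of one step\<close>

context uniform_atlas begin

text \<open>
  By the last part of \<open>step_estimates\<close> the height grows at most by the factor \<open>exp (K1 * T)\<close> along a
  path of length \<open>T\<close>, which in turn bounds the Euclidean speed; a path that starts low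
  therefore needs a long time to cover the distance \<open>\<tau> / 4\<close>.
\<close>

lemma exit_time:
  "\<exists>K e. 0 < K \<and> 0 < e \<and> (\<forall>\<xi>\<in>\<Xi>. \<forall>x l N. hpath \<Omega> (r0 / 2) x l N \<longrightarrow> x 0 \<in> ball \<xi> (\<tau>/4) \<longrightarrow>
     x N \<notin> ball \<xi> (\<tau>/2) \<longrightarrow> exp (- 2 * (\<Sum>k<N. l k)) \<le> K * height \<xi> (x 0) powr e)"
proof -
  \<comment> \<open>\<open>b * K1\<close> is the growth rate of the height raised to the power
    \<open>b\<close>; the extra 1 comes from bounding the total length by
    \<open>exp T\<close>.\<close>
  define \<gamma> where "\<gamma> = b * K1 + 1"
  have \<gamma>: "0 < \<gamma>" using b_pos K1_pos by (simp add: \<gamma>_def add_pos_pos)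
  define P where "P = 4 * K1 / \<tau>"
  have P: "0 < P" using K1_pos \<tau>_pos by (simp add: P_def)
  have "exp (- 2 * (\<Sum>k<N. l k)) \<le> P powr (2 / \<gamma>) * height \<xi> (x 0) powr (2 * b / \<gamma>)"
    if \<xi>: "\<xi> \<in> \<Xi>" and hp: "hpath \<Omega> (r0 / 2) x l N" and x0: "x 0 \<in> ball \<xi> (\<tau>/4)"
      and xN: "x N \<notin> ball \<xi> (\<tau>/2)" for \<xi> x l N
  proof -
    define j where "j = (LEAST k. x k \<notin> ball \<xi> (\<tau>/2))"
    have j: "x j \<notin> ball \<xi> (\<tau>/2)" "j \<le> N" unfolding j_def using xN by (rule LeastI, rule Least_le)
    have before: "x k \<in> ball \<xi> (\<tau>/2)" if "k < j" for k using not_less_Least that by (auto simp: j_def)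
    have j0: "0 < j" using j(1) x0 \<tau>_pos by (cases "j = 0") auto
    define T where "T = (\<Sum>k<N. l k)"
    have l: "0 \<le> l k" "l k \<le> r0 / 2" "hstep \<Omega> (x k) (x (Suc k)) (l k)" if "k < j" for k
      using hp that j(2) by (auto simp: hpath_def hstep_def)
    have tT: "(\<Sum>i<k. l i) \<le> T" if "k \<le> N" for k
      unfolding T_def using hpath_nonneg[OF hp] that by (intro sum_mono2) auto
    have T: "0 \<le> T" using tT[of 0] by simp
    note est = step_estimates[OF \<xi> before l(3,2)]
    define u0 where "u0 = height \<xi> (x 0)"
    have u0: "0 < u0" unfolding u0_def by (rule height_pos[OF \<xi> est(1)[OF j0 j0 j0]])
    have hk: "k \<le> j \<Longrightarrow> height \<xi> (x k) \<le> u0 * exp (K1 * (\<Sum>i<k. l i))" for k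
    proof (induction k)
      case (Suc k)
      hence k: "k < j" by simp
      have "height \<xi> (x (Suc k)) \<le> height \<xi> (x k) * (1 + K1 * l k)" by (rule est[OF k k k])
      also have "\<dots> \<le> (u0 * exp (K1 * (\<Sum>i<k. l i))) * exp (K1 * l k)"
        using Suc.IH k l[OF k] K1_pos u0 by (intro mult_mono exp_ge_add_one_self) auto
      finally show ?case by (simp add: exp_add distrib_left)
    qed (simp add: u0_def)
    have "dist (x 0) (x j) \<le> (\<Sum>i=0..<j. K1 * (u0 * exp (K1 * T)) powr b * l i)"
    proof (rule dist_sum_steps)
      fix k assume "0 \<le> k" and k: "k < j"
      have "height \<xi> (x k) \<le> u0 * exp (K1 * (\<Sum>i<k. l i))" using hk k by simp
      also have "\<dots> \<le> u0 * exp (K1 * T)" using u0 K1_pos tT[of k] k j(2) by simp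
      finally have "height \<xi> (x k) powr b \<le> (u0 * exp (K1 * T)) powr b"
        using height_pos[OF \<xi> est(1)[OF k k k]] b_pos by (intro powr_mono2) auto
      hence "K1 * height \<xi> (x k) powr b * l k \<le> K1 * (u0 * exp (K1 * T)) powr b * l k"
        using K1_pos l[OF k] by (intro mult_right_mono mult_left_mono) auto
      thus "dist (x k) (x (Suc k)) \<le> K1 * (u0 * exp (K1 * T)) powr b * l k"
        using est(3)[OF k k k] by linarith
    qed simp
    also have "\<dots> = K1 * (u0 * exp (K1 * T)) powr b * (\<Sum>i<j. l i)"
      by (simp add: sum_distrib_left lessThan_atLeast0)
    also have "\<dots> \<le> K1 * (u0 * exp (K1 * T)) powr b * exp T"
    proof -
      have "(\<Sum>i<j. l i) \<le> exp T" using tT[OF j(2)] exp_ge_add_one_self[of T] by linarith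
      thus ?thesis using K1_pos by (intro mult_left_mono) auto
    qed
    also have "(u0 * exp (K1 * T)) powr b = u0 powr b * exp (b * K1 * T)"
      using u0 by (simp add: powr_mult exp_powr_real mult_ac)
    also have "K1 * (u0 powr b * exp (b * K1 * T)) * exp T = K1 * u0 powr b * exp (\<gamma> * T)"
      by (simp add: \<gamma>_def distrib_right exp_add)
    finally have d: "dist (x 0) (x j) \<le> K1 * u0 powr b * exp (\<gamma> * T)" .
    have "\<tau> / 4 \<le> dist (x 0) (x j)"
      using x0 j(1) dist_triangle[of \<xi> "x j" "x 0"] by auto
    with d have "\<tau> / 4 \<le> K1 * u0 powr b * exp (\<gamma> * T)" by linarith
    hence "exp (- (\<gamma> * T)) \<le> P * u0 powr b"
      using \<tau>_pos by (simp add: P_def exp_minus field_simps)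
    \<comment> \<open>This exponent produces \<open>exp (- 2 * T)\<close>, the rate at which
      \<open>1 - tanh T\<close> decays.\<close>
    hence "exp (- (\<gamma> * T)) powr (2 / \<gamma>) \<le> (P * u0 powr b) powr (2 / \<gamma>)"
      using \<gamma> by (intro powr_mono2) auto
    moreover have "exp (- (\<gamma> * T)) powr (2 / \<gamma>) = exp (- 2 * T)"
      using \<gamma> by (simp add: exp_powr_real)
    ultimately show ?thesis using P u0
      by (simp add: powr_mult powr_powr T_def[symmetric] u0_def[symmetric] mult.commute)
  qed
  thus ?thesis using P \<gamma> b_pos by (intro exI[of _ "P powr (2 / \<gamma>)"] exI[of _ "2 * b / \<gamma>"]) auto
qed

text \<open>A disc that leaves the chart ball at \<open>z\<close> yields a chain of length
  \<open>poincare_dist 0 z\<close> along a radius. \<open>exit_time\<close> forces it to be long,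
  and \<open>1 - tanh T \<le> 2 * exp (- 2 * T)\<close> then puts \<open>z\<close> near the unit
  circle; hence the factor 2 in the constant.\<close>

lemma strong_localization:
  "\<exists>K e. 0 < K \<and> 0 < e \<and> (\<forall>\<xi>\<in>\<Xi>. \<forall>f z. holo_disc f \<longrightarrow> f ` ball 0 1 \<subseteq> \<Omega> \<longrightarrow> f 0 \<in> ball \<xi> (\<tau>/4) \<longrightarrow>
     cmod z < 1 - K * height \<xi> (f 0) powr e \<longrightarrow> f z \<in> ball \<xi> \<tau>)"
proof -
  obtain K e where Ke: "0 < K" "0 < e" and ex:
    "\<And>\<xi> x l N. \<xi> \<in> \<Xi> \<Longrightarrow> hpath \<Omega> (r0 / 2) x l N \<Longrightarrow> x 0 \<in> ball \<xi> (\<tau>/4) \<Longrightarrow>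
     x N \<notin> ball \<xi> (\<tau>/2) \<Longrightarrow> exp (- 2 * (\<Sum>k<N. l k)) \<le> K * height \<xi> (x 0) powr e"
    using exit_time by blast
  have "f z \<in> ball \<xi> \<tau>" if \<xi>: "\<xi> \<in> \<Xi>" and f: "holo_disc f" "f ` ball 0 1 \<subseteq> \<Omega>" "f 0 \<in> ball \<xi> (\<tau>/4)"
    and z: "cmod z < 1 - 2 * K * height \<xi> (f 0) powr e" for \<xi> f z
  proof (rule ccontr)
    assume n: "f z \<notin> ball \<xi> \<tau>"
    have "0 \<le> 2 * K * height \<xi> (f 0) powr e" using Ke by simp
    hence z1: "cmod z < 1" using z by linarith
    have "hstep \<Omega> (f 0) (f z) (poincare_dist 0 z)" by (rule hstep_of_disc[OF f(1,2)]) (use z1 in auto)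
    from hconn_of_hstep[OF this, of "r0 / 2"] r0(1)
    obtain x l N where h: "hpath \<Omega> (r0/2) x l N" "x 0 = f 0" "x N = f z" "(\<Sum>k<N. l k) = poincare_dist 0 z"
      unfolding hconn_def by auto
    have "f z \<notin> ball \<xi> (\<tau>/2)" using n \<tau>_pos by auto
    with ex[OF \<xi> h(1)] have "exp (- 2 * poincare_dist 0 z) \<le> K * height \<xi> (f 0) powr e"
      using f(3) h by simp
    moreover have "1 - cmod z \<le> 2 * exp (- 2 * poincare_dist 0 z)"
      using one_minus_tanh_le[of "poincare_dist 0 z"] z1 by (simp add: poincare_dist_def tanh_artanh_real)
    ultimately show False using z by linarith
  qed
  thus ?thesis using Ke by (intro exI[of _ "2 * K"] exI[of _ e]) auto
qed

text \<open>The part of the disc of radius \<open>r\<close>, with \<open>1 - r\<close> at most a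
  multiple of a power of the height, stays in the chart. Rescaling it turns the parameter
  \<open>tanh l\<close> into \<open>tanh l / r\<close>, and the resulting artanh exceeds
  \<open>l\<close> only by the stated error.\<close>

lemma local_step_cost:
  "\<exists>Q e. 0 < Q \<and> 0 < e \<and> (\<forall>\<xi>\<in>\<Xi>. \<forall>x y l \<eta>. x \<in> ball \<xi> (\<tau>/4) \<longrightarrow> hstep \<Omega> x y l \<longrightarrow> l \<le> \<eta> \<longrightarrow> \<eta> \<le> r0 / 2 \<longrightarrow>
     kobayashi_dist (\<Omega> \<inter> V \<xi>) x y \<le> ereal (l + Q * (height \<xi> x powr e * l + \<eta> * l)))"
proof -
  obtain K e where Ke: "0 < K" "0 < e" and loc:
    "\<And>\<xi> f z. \<xi> \<in> \<Xi> \<Longrightarrow> holo_disc f \<Longrightarrow> f ` ball 0 1 \<subseteq> \<Omega> \<Longrightarrow> f 0 \<in> ball \<xi> (\<tau>/4) \<Longrightarrow>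
     cmod z < 1 - K * height \<xi> (f 0) powr e \<Longrightarrow> f z \<in> ball \<xi> \<tau>"
    using strong_localization by blast
  define Q where "Q = 2 / r0 * (K + 1)"
  have Q: "0 < Q" using Ke r0 by (simp add: Q_def add_pos_pos)
  have "kobayashi_dist (\<Omega> \<inter> V \<xi>) x y \<le> ereal (l + Q * (height \<xi> x powr e * l + \<eta> * l))"
    if \<xi>: "\<xi> \<in> \<Xi>" and x: "x \<in> ball \<xi> (\<tau>/4)" and st: "hstep \<Omega> x y l" and l: "l \<le> \<eta>" "\<eta> \<le> r0 / 2" for \<xi> x y l \<eta>
  proof -
    obtain f where f: "holo_disc f" "f ` ball 0 1 \<subseteq> \<Omega>" "f 0 = x" "f (of_real (tanh l)) = y" and l0: "0 \<le> l"
      using st unfolding hstep_def by blast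
    define u where "u = height \<xi> x powr e"
    define s where "s = tanh l"
    have s: "0 \<le> s" "s \<le> l" "s \<le> r0 / 2" "s \<le> \<eta>" using l0 l tanh_le_self[OF l0] by (auto simp: s_def)
    have x2: "x \<in> ball \<xi> (\<tau>/2)" using x \<tau>_pos by auto
    have "x \<in> V \<xi> \<inter> \<Omega>" using step_estimates(1)[OF \<xi> x2 st] l by simp
    hence u: "0 < u" using height_pos[OF \<xi>, of x] by (simp add: u_def)
    \<comment> \<open>The lower limit \<open>r0\<close> serves points that are not low, where
      \<open>1 - K * u\<close> may even be negative; radius \<open>r0\<close> is always admissible
      by \<open>disc_stays_local\<close>.\<close>
    define r where "r = max r0 (1 - K * u)"
    have r: "r0 \<le> r" "r < 1" "1 - r \<le> K * u" using r0 Ke u by (auto simp: r_def)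
    have rp: "0 < r" using r r0 by linarith
    have inb: "f z \<in> ball \<xi> \<tau>" if "cmod z < r" for z
      using that loc[OF \<xi> f(1,2), of z] disc_stays_local[OF _ f(1,2), of \<xi> z] x x2 f(3)
      by (auto simp: r_def u_def less_max_iff_disj simp del: mem_ball)
    define g where "g z = f (of_real r * z)" for z
    have rm: "cmod (of_real r * z) < r" "cmod (of_real r * z) < 1" if "cmod z < 1" for z
    proof -
      show 1: "cmod (of_real r * z) < r" using that rp by (simp add: norm_mult)
      show "cmod (of_real r * z) < 1" using 1 r by linarith
    qed
    have g: "holo_disc g" unfolding g_def[abs_def]
      by (rule holo_disc_compose[OF f(1)]) (use rm in \<open>auto intro!: holomorphic_intros\<close>)
    have gV: "g ` ball 0 1 \<subseteq> \<Omega> \<inter> V \<xi>"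
    proof
      fix w assume "w \<in> g ` ball 0 1"
      then obtain z where z: "cmod z < 1" "w = f (of_real r * z)" by (auto simp: g_def)
      show "w \<in> \<Omega> \<inter> V \<xi>" using inb[OF rm(1)[OF z(1)]] ball_V[OF \<xi>] f(2) rm(2)[OF z(1)]
        by (auto simp: z(2) simp del: mem_ball)
    qed
    have sr: "0 \<le> s / r" "s / r < 1" using s r r0 rp by (auto simp: divide_less_eq)
    have "hstep (\<Omega> \<inter> V \<xi>) (g 0) (g (of_real (s / r))) (poincare_dist 0 (of_real (s / r)))"
      by (rule hstep_of_disc[OF g gV]) (use sr in \<open>auto simp del: of_real_divide\<close>)
    moreover have "g 0 = x" "g (of_real (s / r)) = y" using f rp by (simp_all add: g_def s_def)
    moreover have "poincare_dist 0 (of_real (s / r)) = artanh (s / r)"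
      using s(1) rp by (simp add: poincare_dist_def norm_divide)
    ultimately have k: "kobayashi_dist (\<Omega> \<inter> V \<xi>) x y \<le> ereal (artanh (s / r))"
      using kobayashi_le_hstep by metis
    have "artanh (s / r) \<le> s / r / (1 - s / r)" by (rule artanh_le[OF sr])
    also have "\<dots> = s / (r - s)" using rp s r0 r by (simp add: divide_simps)
    \<comment> \<open>In the excess, \<open>1 - r\<close> is the price of shrinking the disc and
      gives the height term, while \<open>s\<close> comes from bounding artanh by a rational
      function and gives the \<open>\<eta>\<close> term.\<close>
    also have "\<dots> = s + s * (1 - r + s) / (r - s)"
    proof -
      have "r - s \<noteq> 0" using s r r0 by linarith
      thus ?thesis by (simp add: field_simps)
    qed
    also have "s * (1 - r + s) / (r - s) \<le> l * (K * u + \<eta>) / (r0 / 2)"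
      using s r r0 l l0 Ke u by (intro frac_le mult_mono mult_nonneg_nonneg) auto
    also have "l * (K * u + \<eta>) / (r0 / 2) = 2 / r0 * (K * (u * l) + 1 * (\<eta> * l))" using r0 by (simp add: field_simps)
    also have "\<dots> \<le> 2 / r0 * ((K + 1) * (u * l) + (K + 1) * (\<eta> * l))"
      using Ke u l0 l r0 s by (intro mult_left_mono add_mono mult_right_mono) auto
    also have "\<dots> = Q * (u * l + \<eta> * l)" using r0(1) by (simp add: Q_def field_simps)
    finally have "artanh (s / r) \<le> l + Q * (u * l + \<eta> * l)" using s by linarith
    thus ?thesis using k by (auto simp: u_def elim!: order_trans)
  qed
  thus ?thesis using Q Ke by blast
qed

end

section \<open>Almost-geodesics\<close>

text \<open>
  Subpaths are length-minimizing up to an error of 1. The bound on \<open>\<eta>\<close> times the length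
  keeps the total cost of replacing \<open>artanh\<close> by its linearization bounded.
\<close>

definition near_geodesic ::
  "(complex^'n) set \<Rightarrow> real \<Rightarrow> (nat \<Rightarrow> complex^'n) \<Rightarrow> (nat \<Rightarrow> real) \<Rightarrow> nat \<Rightarrow> bool" where
  "near_geodesic \<Omega> \<eta> x l N \<longleftrightarrow> hpath \<Omega> \<eta> x l N \<and> \<eta> * (\<Sum>k<N. l k) \<le> 1 \<and>
     (\<forall>i j s. i \<le> j \<longrightarrow> j \<le> N \<longrightarrow> kobayashi_dist \<Omega> (x i) (x j) \<le> ereal s \<longrightarrow> (\<Sum>k=i..<j. l k) \<le> s + 1)"

lemma kobayashi_le_subpath:
  assumes "hpath \<Omega> \<eta> x l N" "\<And>k. k \<le> N \<Longrightarrow> x k \<in> \<Omega>" "i \<le> j" "j \<le> N"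
  shows "kobayashi_dist \<Omega> (x i) (x j) \<le> ereal (\<Sum>k=i..<j. l k)"
  by (rule kobayashi_chain)
     (use assms in \<open>auto simp: hpath_def intro!: kobayashi_le_hstep\<close>)

lemma sum_split3:
  fixes l :: "nat \<Rightarrow> real"
  assumes "i \<le> j" "j \<le> N"
  shows "(\<Sum>k<N. l k) = (\<Sum>k=0..<i. l k) + (\<Sum>k=i..<j. l k) + (\<Sum>k=j..<N. l k)"
  using assms by (simp add: lessThan_atLeast0 sum.atLeastLessThan_concat)

text \<open>If a piece exceeded the distance of its ends by more than 1, replacing it by a nearly
  shortest connection would push the total below the distance of the endpoints.\<close>

lemma near_geodesicI:
  assumes hp: "hpath \<Omega> \<eta> x l N" and mem: "\<And>k. k \<le> N \<Longrightarrow> x k \<in> \<Omega>"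
    and d: "kobayashi_dist \<Omega> (x 0) (x N) = ereal d" and T: "(\<Sum>k<N. l k) \<le> d + 1"
    and \<eta>: "\<eta> * (\<Sum>k<N. l k) \<le> 1"
  shows "near_geodesic \<Omega> \<eta> x l N"
  unfolding near_geodesic_def
proof (intro conjI allI impI hp \<eta>)
  fix i j s assume ij: "i \<le> j" "j \<le> N" and s: "kobayashi_dist \<Omega> (x i) (x j) \<le> ereal s"
  have 1: "kobayashi_dist \<Omega> (x 0) (x i) \<le> ereal (\<Sum>k=0..<i. l k)"
    by (rule kobayashi_le_subpath[OF hp mem]) (use ij in auto)
  have 2: "kobayashi_dist \<Omega> (x j) (x N) \<le> ereal (\<Sum>k=j..<N. l k)"
    by (rule kobayashi_le_subpath[OF hp mem]) (use ij in auto)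
  have "kobayashi_dist \<Omega> (x 0) (x N) \<le> ereal ((\<Sum>k=0..<i. l k) + s + (\<Sum>k=j..<N. l k))"
    by (intro kobayashi_triangle[OF kobayashi_triangle[OF 1 s] 2] mem ij) auto
  hence "d \<le> (\<Sum>k=0..<i. l k) + s + (\<Sum>k=j..<N. l k)" by (simp add: d)
  thus "(\<Sum>k=i..<j. l k) \<le> s + 1" using T sum_split3[OF ij, of l] by linarith
qed

context uniform_atlas begin

text \<open>Let \<open>k0\<close> be the highest index and \<open>s\<close> its arc length. The
  length between \<open>k\<close> and \<open>k0\<close> is at most 1 more than the distance, hence
  at most \<open>B + 1 - A * ln u - A * ln u0\<close> for the two heights. Since
  \<open>u \<le> u0\<close>, this bounds \<open>2 * A * ln u\<close>, which explains the rate
  \<open>1 / (2 * A)\<close>.\<close>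

lemma height_decay:
  "\<exists>K a. 0 < K \<and> 0 < a \<and> (\<forall>\<xi>\<in>\<Xi>. \<forall>\<eta> x l N i j. near_geodesic \<Omega> \<eta> x l N \<longrightarrow> i < j \<longrightarrow> j \<le> N \<longrightarrow>
     (\<forall>k\<in>{i..<j}. x k \<in> V \<xi> \<inter> \<Omega>) \<longrightarrow>
     (\<exists>s. \<forall>k\<in>{i..<j}. height \<xi> (x k) \<le> K * exp (- a * \<bar>(\<Sum>m<k. l m) - s\<bar>)))"
proof -
  obtain A B where AB: "0 < A" "0 < B" and
    up: "\<And>\<xi> x y. \<xi> \<in> \<Xi> \<Longrightarrow> x \<in> V \<xi> \<inter> \<Omega> \<Longrightarrow> y \<in> V \<xi> \<inter> \<Omega> \<Longrightarrow>
     kobayashi_dist (\<Omega> \<inter> V \<xi>) x y \<le> ereal (B - A * ln (height \<xi> x) - A * ln (height \<xi> y))"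
    using kobayashi_local_upper by blast
  have "\<exists>s. \<forall>k\<in>{i..<j}. height \<xi> (x k) \<le> exp ((B + 1) / (2 * A)) * exp (- (1 / (2 * A)) * \<bar>(\<Sum>m<k. l m) - s\<bar>)"
    if \<xi>: "\<xi> \<in> \<Xi>" and ng: "near_geodesic \<Omega> \<eta> x l N" and ij: "i < j" "j \<le> N"
      and mem: "\<forall>k\<in>{i..<j}. x k \<in> V \<xi> \<inter> \<Omega>" for \<xi> \<eta> x l N i j
  proof -
    have "Max ((\<lambda>k. height \<xi> (x k)) ` {i..<j}) \<in> (\<lambda>k. height \<xi> (x k)) ` {i..<j}"
      using ij by (intro Max_in) auto
    then obtain k0 where k0: "k0 \<in> {i..<j}" "height \<xi> (x k0) = Max ((\<lambda>k. height \<xi> (x k)) ` {i..<j})" by auto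
    have mx: "height \<xi> (x k) \<le> height \<xi> (x k0)" if "k \<in> {i..<j}" for k
      unfolding k0(2) using that by (intro Max_ge) auto
    define t where "t k = (\<Sum>m<k. l m)" for k
    have up': "kobayashi_dist \<Omega> (x k) (x m) \<le> ereal (B - A * ln (height \<xi> (x k)) - A * ln (height \<xi> (x m)))"
      if "k \<in> {i..<j}" "m \<in> {i..<j}" for k m
    proof -
      have "kobayashi_dist \<Omega> (x k) (x m) \<le> kobayashi_dist (\<Omega> \<inter> V \<xi>) (x k) (x m)" by (rule kobayashi_mono) auto
      also have "\<dots> \<le> ereal (B - A * ln (height \<xi> (x k)) - A * ln (height \<xi> (x m)))"
        using mem that by (intro up[OF \<xi>]) auto
      finally show ?thesis .
    qed
    have tt: "t m - t k = (\<Sum>j=k..<m. l j)" if "k \<le> m" for k m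
      using sum_split3[of k m m l] that by (simp add: t_def lessThan_atLeast0)
    have mono: "t k \<le> t m" if "k \<le> m" "m \<in> {i..<j}" for k m
    proof -
      have hp: "hpath \<Omega> \<eta> x l N" using ng by (simp add: near_geodesic_def)
      have "0 \<le> (\<Sum>j=k..<m. l j)"
        using that(2) ij(2) by (intro sum_nonneg hpath_nonneg[OF hp]) auto
      thus ?thesis using tt[OF that(1)] by linarith
    qed
    have gap: "t m - t k \<le> B - A * ln (height \<xi> (x k)) - A * ln (height \<xi> (x m)) + 1"
      if "k \<in> {i..<j}" "m \<in> {i..<j}" "k \<le> m" for k m
      unfolding tt[OF that(3)] using ng up'[OF that(1,2)] that ij(2) unfolding near_geodesic_def by auto
    have "height \<xi> (x k) \<le> exp ((B + 1) / (2 * A)) * exp (- (1 / (2 * A)) * \<bar>t k - t k0\<bar>)"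
      if k: "k \<in> {i..<j}" for k
    proof -
      define u where "u = height \<xi> (x k)"
      have u: "0 < u" unfolding u_def by (rule height_pos[OF \<xi>]) (use mem k in auto)
      have "A * ln u \<le> A * ln (height \<xi> (x k0))"
        using mx[OF k] u AB(1) by (simp add: u_def)
      moreover have "\<bar>t k - t k0\<bar> \<le> B - A * ln u - A * ln (height \<xi> (x k0)) + 1"
      proof (cases "k \<le> k0")
        case True
        moreover have "t k \<le> t k0" by (rule mono[OF True k0(1)])
        ultimately show ?thesis using gap[OF k k0(1)] by (simp add: u_def)
      next
        case False
        hence le: "k0 \<le> k" by simp
        moreover have "t k0 \<le> t k" by (rule mono[OF le k])
        ultimately show ?thesis using gap[OF k0(1) k] by (simp add: u_def)
      qed
      ultimately have "2 * A * ln u \<le> B + 1 - \<bar>t k - t k0\<bar>" by linarith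
      hence "ln u \<le> (B + 1 - \<bar>t k - t k0\<bar>) / (2 * A)" using AB(1) by (simp add: field_simps)
      hence "u \<le> exp ((B + 1 - \<bar>t k - t k0\<bar>) / (2 * A))" using u by (metis exp_le_cancel_iff exp_ln)
      also have "\<dots> = exp ((B + 1) / (2 * A)) * exp (- (1 / (2 * A)) * \<bar>t k - t k0\<bar>)"
        by (simp add: diff_divide_distrib flip: exp_add)
      finally show ?thesis by (simp add: u_def)
    qed
    thus ?thesis unfolding t_def by blast
  qed
  thus ?thesis using AB by (intro exI[of _ "exp ((B + 1) / (2 * A))"] exI[of _ "1 / (2 * A)"]) auto
qed

lemma height_powr_sum:
  assumes "0 < e"
  shows "\<exists>K. 0 < K \<and> (\<forall>\<xi>\<in>\<Xi>. \<forall>\<eta> x l N i j. near_geodesic \<Omega> \<eta> x l N \<longrightarrow> \<eta> \<le> 1 \<longrightarrow> i \<le> j \<longrightarrow> j \<le> N \<longrightarrow>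
     (\<forall>k\<in>{i..<j}. x k \<in> V \<xi> \<inter> \<Omega>) \<longrightarrow> (\<Sum>k=i..<j. height \<xi> (x k) powr e * l k) \<le> K)"
proof -
  obtain K a where Ka: "0 < K" "0 < a" and dec: "\<forall>\<xi>\<in>\<Xi>. \<forall>\<eta> x l N i j. near_geodesic \<Omega> \<eta> x l N \<longrightarrow> i < j \<longrightarrow> j \<le> N \<longrightarrow>
     (\<forall>k\<in>{i..<j}. x k \<in> V \<xi> \<inter> \<Omega>) \<longrightarrow>
     (\<exists>s. \<forall>k\<in>{i..<j}. height \<xi> (x k) \<le> K * exp (- a * \<bar>(\<Sum>m<k. l m) - s\<bar>))"
    using height_decay by (elim exE conjE) (rule that)
  \<comment> \<open>Lowering the rate to at most 1 ensures \<open>c' * l k \<le> 1\<close>, as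
    \<open>sum_exp_abs_le\<close> demands, and only weakens the decay.\<close>
  define c' where "c' = min 1 (a * e)"
  have c': "0 < c'" "c' \<le> 1" "c' \<le> a * e" using Ka assms by (auto simp: c'_def)
  have "(\<Sum>k=i..<j. height \<xi> (x k) powr e * l k) \<le> K powr e * (4 / c')"
    if \<xi>: "\<xi> \<in> \<Xi>" and ng: "near_geodesic \<Omega> \<eta> x l N" and \<eta>: "\<eta> \<le> 1" and ij: "i \<le> j" "j \<le> N"
      and mem: "\<forall>k\<in>{i..<j}. x k \<in> V \<xi> \<inter> \<Omega>" for \<xi> \<eta> x l N i j
  proof (cases "i = j")
    case True
    thus ?thesis using c' by simp
  next
    case False
    hence "i < j" using ij(1) by simp
    from dec[rule_format, OF \<xi> ng this ij(2) mem[rule_format]]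
    obtain s where s: "\<forall>k\<in>{i..<j}. height \<xi> (x k) \<le> K * exp (- a * \<bar>(\<Sum>m<k. l m) - s\<bar>)"
      by blast
    have l: "0 \<le> l k" "l k \<le> 1" if "k < j" for k
    proof -
      have kN: "k < N" and hp: "hpath \<Omega> \<eta> x l N" using that ij(2) ng by (auto simp: near_geodesic_def)
      show "0 \<le> l k" by (rule hpath_nonneg[OF hp kN])
      have "l k \<le> \<eta>" using hp kN by (simp add: hpath_def)
      thus "l k \<le> 1" using \<eta> by simp
    qed
    have "(\<Sum>k=i..<j. height \<xi> (x k) powr e * l k) \<le>
        (\<Sum>k=i..<j. K powr e * (l k * exp (- c' * \<bar>(\<Sum>m<k. l m) - s\<bar>)))"
    proof (rule sum_mono)
      fix k assume k: "k \<in> {i..<j}"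
      have "height \<xi> (x k) powr e \<le> (K * exp (- a * \<bar>(\<Sum>m<k. l m) - s\<bar>)) powr e"
        using s k assms height_pos[OF \<xi>, of "x k"] mem by (intro powr_mono2) (auto intro: less_imp_le)
      also have "\<dots> = K powr e * exp (- (a * e * \<bar>(\<Sum>m<k. l m) - s\<bar>))"
        using Ka by (simp add: powr_mult exp_powr_real mult_ac)
      also have "\<dots> \<le> K powr e * exp (- c' * \<bar>(\<Sum>m<k. l m) - s\<bar>)"
        using c'(3) by (intro mult_left_mono) (auto intro!: mult_right_mono)
      finally have "height \<xi> (x k) powr e * l k \<le> K powr e * exp (- c' * \<bar>(\<Sum>m<k. l m) - s\<bar>) * l k"
        using l[of k] k by (intro mult_right_mono) auto
      thus "height \<xi> (x k) powr e * l k \<le> K powr e * (l k * exp (- c' * \<bar>(\<Sum>m<k. l m) - s\<bar>))"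
        by (simp add: mult_ac)
    qed
    also have "\<dots> = K powr e * (\<Sum>k=i..<j. l k * exp (- c' * \<bar>(\<Sum>m<k. l m) - s\<bar>))"
      by (simp add: sum_distrib_left)
    also have "\<dots> \<le> K powr e * (4 / c')"
      using l c' mult_mono[of c' 1 _ 1]
      by (intro mult_left_mono sum_exp_abs_le[where t = "\<lambda>k. \<Sum>m<k. l m"] ij(1) c'(1)) auto
    finally show ?thesis .
  qed
  thus ?thesis using Ka c' by (intro exI[of _ "K powr e * (4 / c')"]) auto
qed

section \<open>Localization and visibility of almost-geodesics\<close>

lemma near_geodesic_in_\<Omega>:
  "near_geodesic \<Omega> \<eta> x l N \<Longrightarrow> k < N \<Longrightarrow> x k \<in> \<Omega>"
  unfolding near_geodesic_def hpath_def hstep_def by (metis centre_in_ball image_subset_iff zero_less_one)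

text \<open>Summing the step costs, the height terms are bounded by \<open>height_powr_sum\<close>
  and the \<open>\<eta>\<close> terms by \<open>\<eta>\<close> times the total length. No step
  starts at \<open>x j\<close>, so that point need only lie in the chart; the ball condition stops
  one index earlier.\<close>

lemma near_geodesic_localization:
  "\<exists>K. 0 < K \<and> (\<forall>\<xi>\<in>\<Xi>. \<forall>\<eta> x l N i j. near_geodesic \<Omega> \<eta> x l N \<longrightarrow> \<eta> \<le> r0 / 2 \<longrightarrow> i \<le> j \<longrightarrow> j \<le> N \<longrightarrow>
     (\<forall>k\<in>{i..<j}. x k \<in> ball \<xi> (\<tau>/4)) \<longrightarrow> x j \<in> V \<xi> \<inter> \<Omega> \<longrightarrow>
     kobayashi_dist (\<Omega> \<inter> V \<xi>) (x i) (x j) \<le> ereal ((\<Sum>k=i..<j. l k) + K))"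
proof -
  obtain Q e where Qe: "0 < Q" "0 < e" and cost:
    "\<And>\<xi> x y l \<eta>. \<xi> \<in> \<Xi> \<Longrightarrow> x \<in> ball \<xi> (\<tau>/4) \<Longrightarrow> hstep \<Omega> x y l \<Longrightarrow> l \<le> \<eta> \<Longrightarrow> \<eta> \<le> r0 / 2 \<Longrightarrow>
     kobayashi_dist (\<Omega> \<inter> V \<xi>) x y \<le> ereal (l + Q * (height \<xi> x powr e * l + \<eta> * l))"
    using local_step_cost by blast
  obtain K where K: "0 < K" and hs: "\<And>\<xi> \<eta> x l N i j. \<xi> \<in> \<Xi> \<Longrightarrow> near_geodesic \<Omega> \<eta> x l N \<Longrightarrow> \<eta> \<le> 1 \<Longrightarrow> i \<le> j \<Longrightarrow> j \<le> N \<Longrightarrow>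
     (\<forall>k\<in>{i..<j}. x k \<in> V \<xi> \<inter> \<Omega>) \<Longrightarrow> (\<Sum>k=i..<j. height \<xi> (x k) powr e * l k) \<le> K"
    using height_powr_sum[OF Qe(2)] by blast
  have "kobayashi_dist (\<Omega> \<inter> V \<xi>) (x i) (x j) \<le> ereal ((\<Sum>k=i..<j. l k) + Q * (K + 1))"
    if \<xi>: "\<xi> \<in> \<Xi>" and ng: "near_geodesic \<Omega> \<eta> x l N" and \<eta>: "\<eta> \<le> r0 / 2" and ij: "i \<le> j" "j \<le> N"
      and ball: "\<forall>k\<in>{i..<j}. x k \<in> ball \<xi> (\<tau>/4)" and xj: "x j \<in> V \<xi> \<inter> \<Omega>" for \<xi> \<eta> x l N i j
  proof -
    have hp: "hpath \<Omega> \<eta> x l N" and \<eta>T: "\<eta> * (\<Sum>k<N. l k) \<le> 1" using ng by (auto simp: near_geodesic_def)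
    have mem: "x k \<in> V \<xi> \<inter> \<Omega>" if "k \<in> {i..<j}" for k
    proof -
      have "x k \<in> ball \<xi> \<tau>" using ball that \<tau>_pos by force
      thus ?thesis using ball_V[OF \<xi>] near_geodesic_in_\<Omega>[OF ng, of k] that ij(2) by auto
    qed
    have "kobayashi_dist (\<Omega> \<inter> V \<xi>) (x i) (x j) \<le>
        ereal (\<Sum>k=i..<j. l k + Q * (height \<xi> (x k) powr e * l k + \<eta> * l k))"
    proof (rule kobayashi_chain[OF ij(1)])
      fix k assume k: "i \<le> k" "k < j"
      have "hstep \<Omega> (x k) (x (Suc k)) (l k)" "l k \<le> \<eta>" using hp k ij(2) by (auto simp: hpath_def)
      from cost[OF \<xi> _ this \<eta>] show "x k \<in> \<Omega> \<inter> V \<xi> \<and> kobayashi_dist (\<Omega> \<inter> V \<xi>) (x k) (x (Suc k)) \<le>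
          ereal (l k + Q * (height \<xi> (x k) powr e * l k + \<eta> * l k))" using k ball mem[of k] by auto
    qed (use xj in auto)
    also have "(\<Sum>k=i..<j. l k + Q * (height \<xi> (x k) powr e * l k + \<eta> * l k)) =
        (\<Sum>k=i..<j. l k) + Q * ((\<Sum>k=i..<j. height \<xi> (x k) powr e * l k) + \<eta> * (\<Sum>k=i..<j. l k))"
      by (simp add: sum.distrib sum_distrib_left distrib_left)
    also have "(\<Sum>k=i..<j. height \<xi> (x k) powr e * l k) \<le> K"
      by (rule hs[OF \<xi> ng _ ij]) (use mem \<eta> r0 in auto)
    also have "\<eta> * (\<Sum>k=i..<j. l k) \<le> 1"
    proof (cases "i = j")
      case False
      \<comment> \<open>An existing step supplies the sign of \<open>\<eta>\<close>, which
        \<open>near_geodesic\<close> does not state.\<close>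
      hence "0 \<le> l i \<and> l i \<le> \<eta>" using hp ij by (auto simp: hpath_def hstep_def)
      moreover have "(\<Sum>k=i..<j. l k) \<le> (\<Sum>k<N. l k)"
        using ij hpath_nonneg[OF hp] by (intro sum_mono2) auto
      ultimately have "\<eta> * (\<Sum>k=i..<j. l k) \<le> \<eta> * (\<Sum>k<N. l k)" by (intro mult_left_mono) auto
      thus ?thesis using \<eta>T by linarith
    qed simp
    finally show ?thesis using Qe by (simp add: mult_left_mono)
  qed
  thus ?thesis using Qe K by (intro exI[of _ "Q * (K + 1)"]) auto
qed

text \<open>In the speed bound \<open>height powr b\<close> one half of the exponent is estimated by
  \<open>H\<close> and the other half is summed by \<open>height_powr_sum\<close>. The displacement
  therefore tends to 0 with \<open>H\<close>, however long the piece is.\<close>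

lemma near_geodesic_visibility:
  "\<exists>K. 0 < K \<and> (\<forall>\<xi>\<in>\<Xi>. \<forall>\<eta> x l N i j H. near_geodesic \<Omega> \<eta> x l N \<longrightarrow> \<eta> \<le> r0 / 2 \<longrightarrow> i \<le> j \<longrightarrow> j \<le> N \<longrightarrow>
     (\<forall>k\<in>{i..<j}. x k \<in> ball \<xi> (\<tau>/4) \<and> height \<xi> (x k) \<le> H) \<longrightarrow> dist (x i) (x j) \<le> K * H powr (b / 2))"
proof -
  have "0 < b / 2" using b_pos by simp
  from height_powr_sum[OF this]
  obtain K where K: "0 < K" and hs: "\<And>\<xi> \<eta> x l N i j. \<xi> \<in> \<Xi> \<Longrightarrow> near_geodesic \<Omega> \<eta> x l N \<Longrightarrow> \<eta> \<le> 1 \<Longrightarrow> i \<le> j \<Longrightarrow> j \<le> N \<Longrightarrow>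
     (\<forall>k\<in>{i..<j}. x k \<in> V \<xi> \<inter> \<Omega>) \<Longrightarrow> (\<Sum>k=i..<j. height \<xi> (x k) powr (b / 2) * l k) \<le> K" by blast
  have "dist (x i) (x j) \<le> K1 * K * H powr (b / 2)"
    if \<xi>: "\<xi> \<in> \<Xi>" and ng: "near_geodesic \<Omega> \<eta> x l N" and \<eta>: "\<eta> \<le> r0 / 2" and ij: "i \<le> j" "j \<le> N"
      and ball: "\<forall>k\<in>{i..<j}. x k \<in> ball \<xi> (\<tau>/4) \<and> height \<xi> (x k) \<le> H" for \<xi> \<eta> x l N i j H
  proof -
    have hp: "hpath \<Omega> \<eta> x l N" using ng by (auto simp: near_geodesic_def)
    have st: "hstep \<Omega> (x k) (x (Suc k)) (l k)" "l k \<le> r0 / 2" "0 \<le> l k" "x k \<in> ball \<xi> (\<tau>/2)" if k: "k \<in> {i..<j}" for k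
    proof -
      have kN: "k < N" using k ij(2) by auto
      show 1: "hstep \<Omega> (x k) (x (Suc k)) (l k)" "l k \<le> r0 / 2"
        using hp kN \<eta> unfolding hpath_def by (blast intro: order_trans)+
      show "0 \<le> l k" using 1 by (simp add: hstep_def)
      show "x k \<in> ball \<xi> (\<tau>/2)" using bspec[OF ball k] \<tau>_pos by auto
    qed
    note est = step_estimates[OF \<xi> st(4,1,2)]
    have "dist (x i) (x j) \<le> (\<Sum>k=i..<j. K1 * H powr (b / 2) * (height \<xi> (x k) powr (b / 2) * l k))"
    proof (rule dist_sum_steps[OF ij(1)])
      fix k assume "i \<le> k" "k < j"
      hence k: "k \<in> {i..<j}" by simp
      have h: "0 < height \<xi> (x k)" by (rule height_pos[OF \<xi> est(1)[OF k k k]])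
      have "height \<xi> (x k) powr b = height \<xi> (x k) powr (b / 2) * height \<xi> (x k) powr (b / 2)"
        by (simp flip: powr_add)
      also have "\<dots> \<le> H powr (b / 2) * height \<xi> (x k) powr (b / 2)"
        using h ball k b_pos by (intro mult_right_mono powr_mono2) auto
      finally have "K1 * height \<xi> (x k) powr b * l k \<le> K1 * (H powr (b / 2) * height \<xi> (x k) powr (b / 2)) * l k"
        using K1_pos st(3)[OF k] by (intro mult_right_mono mult_left_mono) auto
      thus "dist (x k) (x (Suc k)) \<le> K1 * H powr (b / 2) * (height \<xi> (x k) powr (b / 2) * l k)"
        using est(3)[OF k k k] by (simp add: mult_ac)
    qed
    also have "\<dots> = K1 * H powr (b / 2) * (\<Sum>k=i..<j. height \<xi> (x k) powr (b / 2) * l k)"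
      by (simp only: sum_distrib_left)
    also have "\<dots> \<le> K1 * H powr (b / 2) * K"
      using hs[OF \<xi> ng _ ij] \<eta> r0 est(1) K1_pos by (intro mult_left_mono) auto
    finally show ?thesis by (simp add: mult_ac)
  qed
  thus ?thesis using K K1_pos by (intro exI[of _ "K1 * K"]) auto
qed

lemma kobayashi_localization:
  "\<exists>K. 0 < K \<and> (\<forall>\<xi>\<in>\<Xi>. \<forall>p\<in>ball \<xi> (\<tau>/8) \<inter> \<Omega>. \<forall>q\<in>ball \<xi> (\<tau>/8) \<inter> \<Omega>.
     kobayashi_dist (\<Omega> \<inter> V \<xi>) p q \<le> kobayashi_dist \<Omega> p q + ereal K)"
proof -
  obtain K where K: "0 < K" and loc: "\<And>\<xi> \<eta> x l N i j. \<xi> \<in> \<Xi> \<Longrightarrow> near_geodesic \<Omega> \<eta> x l N \<Longrightarrow> \<eta> \<le> r0 / 2 \<Longrightarrow> i \<le> j \<Longrightarrow> j \<le> N \<Longrightarrow>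
     (\<forall>k\<in>{i..<j}. x k \<in> ball \<xi> (\<tau>/4)) \<Longrightarrow> x j \<in> V \<xi> \<inter> \<Omega> \<Longrightarrow>
     kobayashi_dist (\<Omega> \<inter> V \<xi>) (x i) (x j) \<le> ereal ((\<Sum>k=i..<j. l k) + K)"
    using near_geodesic_localization by blast
  obtain Kv where Kv: "0 < Kv" and vis: "\<And>\<xi> \<eta> x l N i j H. \<xi> \<in> \<Xi> \<Longrightarrow> near_geodesic \<Omega> \<eta> x l N \<Longrightarrow> \<eta> \<le> r0 / 2 \<Longrightarrow> i \<le> j \<Longrightarrow> j \<le> N \<Longrightarrow>
     (\<forall>k\<in>{i..<j}. x k \<in> ball \<xi> (\<tau>/4) \<and> height \<xi> (x k) \<le> H) \<Longrightarrow> dist (x i) (x j) \<le> Kv * H powr (b / 2)"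
    using near_geodesic_visibility by blast
  obtain A B where AB: "0 < A" "0 < B" and
    up: "\<And>\<xi> x y. \<xi> \<in> \<Xi> \<Longrightarrow> x \<in> V \<xi> \<inter> \<Omega> \<Longrightarrow> y \<in> V \<xi> \<inter> \<Omega> \<Longrightarrow>
     kobayashi_dist (\<Omega> \<inter> V \<xi>) x y \<le> ereal (B - A * ln (height \<xi> x) - A * ln (height \<xi> y))"
    using kobayashi_local_upper by blast
  \<comment> \<open>With this threshold a piece that stays below height \<open>h\<close> moves by at
    most \<open>\<tau> / 32\<close>, too little to cross from the ball of radius
    \<open>\<tau> / 8\<close> to the outside of that of radius \<open>\<tau> / 4\<close>.\<close>
  define h where "h = (\<tau> / (32 * Kv)) powr (2 / b)"
  have h: "0 < h" "Kv * h powr (b / 2) < \<tau> / 16"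
    using \<tau>_pos Kv b_pos by (auto simp: h_def powr_powr)
  define E where "E = A * \<bar>ln h\<bar>"
  have E: "0 \<le> E" using AB by (simp add: E_def)
  \<comment> \<open>\<open>K\<close> for each of the two end pieces, \<open>B + 2 * E\<close> for
    the jump between the two high points, and 1 for the chain's excess over the distance.\<close>
  define K' where "K' = 2 * K + B + 2 * E + 1"
  have K': "K + 1 \<le> K'" using K AB E by (simp add: K'_def)
  have "kobayashi_dist (\<Omega> \<inter> V \<xi>) p q \<le> kobayashi_dist \<Omega> p q + ereal K'"
    if \<xi>: "\<xi> \<in> \<Xi>" and p: "p \<in> ball \<xi> (\<tau>/8) \<inter> \<Omega>" and q: "q \<in> ball \<xi> (\<tau>/8) \<inter> \<Omega>" for \<xi> p q
  \<comment> \<open>The value is an extended real. If no chain joins the points it is infinite and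
    the claim is trivial; lengths are nonnegative, so minus infinity cannot occur.\<close>
  proof (cases "kobayashi_dist \<Omega> p q")
    case PInf
    thus ?thesis by simp
  next
    case MInf
    hence "kobayashi_dist \<Omega> p q < ereal 0" by simp
    then obtain S x l N where "S < 0" "hpath \<Omega> 1 x l N" "(\<Sum>k<N. l k) = S"
      using hconn_of_kobayashi_less[of \<Omega> p q 0 1] unfolding hconn_def by auto
    moreover from this have "0 \<le> S" using hpath_nonneg by (metis sum_nonneg lessThan_iff)
    ultimately show ?thesis by simp
  next
    case (real d)
    \<comment> \<open>The three bounds admit the step estimates, keep a single step below
      \<open>\<tau> / 16\<close>, and make \<open>\<eta>\<close> times the length at most 1. Only
      the last depends on \<open>d\<close>, and no constant depends on
      \<open>\<eta>\<close>.\<close>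
    define \<eta> where "\<eta> = Min {r0 / 2, \<tau> / (16 * K1), 1 / (\<bar>d\<bar> + 1)}"
    have \<eta>: "0 < \<eta>" "\<eta> \<le> r0 / 2" "\<eta> \<le> \<tau> / (16 * K1)" "\<eta> \<le> 1 / (\<bar>d\<bar> + 1)"
      using r0(1) \<tau>_pos K1_pos by (auto simp: \<eta>_def)
    have "kobayashi_dist \<Omega> p q < ereal (d + 1)" using real by simp
    from hconn_of_kobayashi_less[OF this \<eta>(1)]
    obtain x l N where hp: "hpath \<Omega> \<eta> x l N" and x: "x 0 = p" "x N = q" and T: "(\<Sum>k<N. l k) < d + 1"
      unfolding hconn_def by auto
    have mem: "x k \<in> \<Omega>" if "k \<le> N" for k
    proof (cases "k = N")
      case True thus ?thesis using x q by simp
    next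
      case False
      hence "hstep \<Omega> (x k) (x (Suc k)) (l k)" using hp that by (auto simp: hpath_def)
      thus ?thesis unfolding hstep_def by (metis centre_in_ball image_subset_iff zero_less_one)
    qed
    have "\<eta> * (\<Sum>k<N. l k) \<le> 1 / (\<bar>d\<bar> + 1) * (\<bar>d\<bar> + 1)"
    proof (rule mult_mono)
      show "0 \<le> (\<Sum>k<N. l k)" using hpath_nonneg[OF hp] by (intro sum_nonneg) auto
    qed (use \<eta> T in auto)
    also have "\<dots> = 1" by (simp add: add_nonneg_eq_0_iff)
    finally have ng: "near_geodesic \<Omega> \<eta> x l N"
      using hp mem real x T by (intro near_geodesicI[where d=d]) auto
    have qV: "q \<in> V \<xi> \<inter> \<Omega>" using q \<tau>_pos ball_V[OF \<xi>] by force
    have "kobayashi_dist (\<Omega> \<inter> V \<xi>) p q \<le> ereal ((\<Sum>k<N. l k) + (K' - 1))"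
    proof (cases "\<forall>k<N. x k \<in> ball \<xi> (\<tau>/4)")
      case True
      have "kobayashi_dist (\<Omega> \<inter> V \<xi>) (x 0) (x N) \<le> ereal ((\<Sum>k=0..<N. l k) + K)"
        by (rule loc[OF \<xi> ng \<eta>(2)]) (use True x qV in auto)
      also have "\<dots> \<le> ereal ((\<Sum>k<N. l k) + (K' - 1))" using K' by (simp add: lessThan_atLeast0)
      finally show ?thesis by (simp add: x)
    next
      case False
      define S where "S = {k. k < N \<and> x k \<notin> ball \<xi> (\<tau>/4)}"
      have S: "finite S" "S \<noteq> {}" using False by (auto simp: S_def)
      define i where "i = Min S"
      define j where "j = Max S"
      have i: "i < N" "x i \<notin> ball \<xi> (\<tau>/4)" using Min_in[OF S] by (auto simp: i_def S_def)
      have j: "j < N" "x j \<notin> ball \<xi> (\<tau>/4)" using Max_in[OF S] by (auto simp: j_def S_def)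
      have ij: "i \<le> j" using S by (simp add: i_def j_def)
      have bi: "x k \<in> ball \<xi> (\<tau>/4)" if "k < i" for k
      proof (rule ccontr)
        assume "x k \<notin> ball \<xi> (\<tau>/4)"
        hence "k \<in> S" using that i(1) by (simp add: S_def del: mem_ball)
        hence "i \<le> k" using S(1) by (simp add: i_def)
        thus False using that by simp
      qed
      have bj: "x k \<in> ball \<xi> (\<tau>/4)" if "j < k" "k < N" for k
      proof (rule ccontr)
        assume "x k \<notin> ball \<xi> (\<tau>/4)"
        hence "k \<in> S" using that by (simp add: S_def del: mem_ball)
        hence "k \<le> j" using S(1) by (simp add: j_def)
        thus False using that by simp
      qed
      have "\<exists>m<i. h < height \<xi> (x m)"
      proof (rule ccontr)
        assume "\<not> ?thesis"
        hence "height \<xi> (x k) \<le> h" if "k < i" for k using that by (meson not_less)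
        hence "dist (x 0) (x i) \<le> Kv * h powr (b / 2)"
          using bi i(1) by (intro vis[OF \<xi> ng \<eta>(2)]) (simp_all del: mem_ball)
        moreover have "\<tau> / 8 \<le> dist (x 0) (x i)" using p i(2) dist_triangle[of \<xi> "x i" "x 0"] by (auto simp: x)
        ultimately show False using h(2) \<tau>_pos by linarith
      qed
      then obtain m where m: "m < i" "h < height \<xi> (x m)" by blast
      \<comment> \<open>The return is not symmetric to the exit: \<open>x j\<close> is outside the
        ball, so visibility applies only from \<open>Suc j\<close>, and the step from
        \<open>j\<close> is bounded separately. The three distances \<open>\<tau> / 8\<close>,
        \<open>\<tau> / 16\<close>, \<open>\<tau> / 16\<close> add up to \<open>\<tau> / 4\<close>,
        with strict inequality.\<close>
      have "\<exists>m. j < m \<and> m < N \<and> h < height \<xi> (x m)"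
      proof (rule ccontr)
        assume "\<not> ?thesis"
        hence "height \<xi> (x k) \<le> h" if "j < k" "k < N" for k using that by (meson not_less)
        hence "dist (x (Suc j)) (x N) \<le> Kv * h powr (b / 2)"
          using bj j(1) by (intro vis[OF \<xi> ng \<eta>(2)]) (simp_all add: Suc_le_eq del: mem_ball)
        moreover have "dist (x j) (x (Suc j)) \<le> \<tau> / 16"
        proof -
          have st: "hstep \<Omega> (x j) (x (Suc j)) (l j)" "l j \<le> \<eta>" using hp j(1) by (auto simp: hpath_def)
          have "dist (x j) (x (Suc j)) \<le> K1 * l j" by (rule step_displacement[OF st(1)]) (use st \<eta> in auto)
          also have "\<dots> \<le> K1 * (\<tau> / (16 * K1))" using st \<eta>(3) K1_pos by (intro mult_left_mono) auto
          finally show ?thesis using K1_pos by simp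
        qed
        moreover have "\<tau> / 4 \<le> dist \<xi> (x j)" "dist \<xi> (x N) < \<tau> / 8" using j(2) q x by auto
        moreover have "dist \<xi> (x j) \<le> dist \<xi> (x N) + dist (x (Suc j)) (x N) + dist (x j) (x (Suc j))"
          using dist_triangle[of \<xi> "x j" "x (Suc j)"] dist_triangle[of \<xi> "x (Suc j)" "x N"]
            dist_commute[of "x j" "x (Suc j)"] dist_commute[of "x N" "x (Suc j)"] by linarith
        ultimately show False using h(2) \<tau>_pos by linarith
      qed
      then obtain n where n: "j < n" "n < N" "h < height \<xi> (x n)" by blast
      have VV: "x k \<in> V \<xi> \<inter> \<Omega>" if "k = m \<or> k = n" for k
      proof -
        have "x k \<in> ball \<xi> (\<tau>/4)" using that bi bj m n by auto
        hence "x k \<in> ball \<xi> \<tau>" using \<tau>_pos by auto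
        thus ?thesis using ball_V[OF \<xi>] mem[of k] that m n i by auto
      qed
      have 1: "kobayashi_dist (\<Omega> \<inter> V \<xi>) (x 0) (x m) \<le> ereal ((\<Sum>k=0..<m. l k) + K)"
        by (rule loc[OF \<xi> ng \<eta>(2)]) (use m i bi VV in auto)
      have 3: "kobayashi_dist (\<Omega> \<inter> V \<xi>) (x n) (x N) \<le> ereal ((\<Sum>k=n..<N. l k) + K)"
        by (rule loc[OF \<xi> ng \<eta>(2)]) (use n bj x qV in auto)
      \<comment> \<open>The path between \<open>m\<close> and \<open>n\<close> may leave the chart
        and is discarded; its nonnegative length is dropped from the total.\<close>
      have 2: "kobayashi_dist (\<Omega> \<inter> V \<xi>) (x m) (x n) \<le> ereal (B - A * ln (height \<xi> (x m)) - A * ln (height \<xi> (x n)))"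
        using VV by (intro up[OF \<xi>]) auto
      have "kobayashi_dist (\<Omega> \<inter> V \<xi>) (x 0) (x N) \<le> ereal (((\<Sum>k=0..<m. l k) + K) +
          (B - A * ln (height \<xi> (x m)) - A * ln (height \<xi> (x n))) + ((\<Sum>k=n..<N. l k) + K))"
        by (rule kobayashi_triangle[OF kobayashi_triangle[OF 1 2] 3]) (use VV x qV in auto)
      also have "\<dots> \<le> ereal ((\<Sum>k<N. l k) + (K' - 1))"
      proof -
        have "(\<Sum>k=0..<m. l k) + (\<Sum>k=n..<N. l k) \<le> (\<Sum>k<N. l k)"
        proof -
          have "0 \<le> (\<Sum>k=m..<n. l k)" using hpath_nonneg[OF hp] n by (intro sum_nonneg) auto
          thus ?thesis using sum_split3[of m n N l] m n ij by simp
        qed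
        moreover have "- (A * ln u) \<le> E" if "h < u" for u
        proof -
          have "ln h \<le> ln u" using that h(1) by simp
          hence "A * (- ln u) \<le> A * \<bar>ln h\<bar>" using AB by (intro mult_left_mono) auto
          thus ?thesis by (simp add: E_def)
        qed
        note this[OF m(2)] this[OF n(3)]
        ultimately have "((\<Sum>k=0..<m. l k) + K) + (B - A * ln (height \<xi> (x m)) - A * ln (height \<xi> (x n))) +
            ((\<Sum>k=n..<N. l k) + K) \<le> (\<Sum>k<N. l k) + (K' - 1)" unfolding K'_def by linarith
        thus ?thesis by simp
      qed
      finally show ?thesis by (simp add: x)
    qed
    also have "\<dots> \<le> ereal (d + K')" using T by simp
    finally show ?thesis using real by simp
  qed
  moreover have "0 < K'" using K' K by simp
  ultimately show ?thesis by blast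
qed

end

section \<open>Uniform constants from the good atlas\<close>

lemma line_type_ge_1:
  fixes r :: "complex^'n \<Rightarrow> real"
  assumes r: "local_defining_fn k S y r U" and y: "y \<in> S"
  shows "1 \<le> line_type r y"
proof -
  \<comment> \<open>The all-ones vector serves as a nonzero direction; continuity and
    \<open>r y = 0\<close> already give order of vanishing at least 1.\<close>
  define g where "g t = r (y + t *s (1 :: complex^'n))" for t :: complex
  have yU: "y \<in> U" "r y = 0" using r y unfolding local_defining_fn_def by auto
  then obtain D where "(r has_derivative D) (at y)" using r unfolding local_defining_fn_def by blast
  hence "isCont r y" by (rule has_derivative_continuous)
  moreover have "((\<lambda>t::complex. y + t *s (1 :: complex^'n)) \<longlongrightarrow> y) (at 0)"
  proof (rule Lim_null[THEN iffD2])
    have "((\<lambda>t::complex. cmod t * norm (1 :: complex^'n)) \<longlongrightarrow> 0 * norm (1 :: complex^'n)) (at 0)"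
      by (intro tendsto_mult_right tendsto_norm_zero tendsto_ident_at)
    thus "((\<lambda>t::complex. y + t *s (1 :: complex^'n) - y) \<longlongrightarrow> 0) (at 0)"
      by (subst tendsto_norm_zero_iff[symmetric]) (simp add: norm_scale_vec)
  qed
  ultimately have "(g \<longlongrightarrow> r y) (at 0)" unfolding g_def by (rule isCont_tendsto_compose)
  hence g0: "(g \<longlongrightarrow> 0) (at 0)" by (simp add: yU)
  have "eventually (\<lambda>t. \<bar>g t\<bar> \<le> e) (at 0)" if "0 < e" for e
    using tendstoD[OF g0 that] by (rule eventually_mono) simp
  hence "vanishes_to_order g 1" unfolding vanishes_to_order_def by simp
  hence "enat 1 \<le> vanishing_order g" unfolding vanishing_order_def by (intro Sup_upper) blast
  also have "\<dots> \<le> line_type r y"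
    unfolding line_type_def g_def by (rule SUP_upper) (auto simp: vec_eq_iff)
  finally show ?thesis by (simp add: one_enat_def)
qed

text \<open>Makes the exponent \<open>1 / L\<close> positive. A point where the type equals
  \<open>L\<close> exists by definition, and line type is at least 1.\<close>

lemma finite_local_line_type_pos:
  fixes \<Omega> :: "(complex^'n) set"
  assumes "finite_local_line_type \<Omega> L"
  shows "0 < L"
proof -
  obtain V :: "complex^'n \<Rightarrow> (complex^'n) set" and \<Phi> :: "complex^'n \<Rightarrow> complex^'n \<Rightarrow> complex^'n" and \<xi> y r U where *: "y \<in> \<Phi> \<xi> ` (frontier \<Omega> \<inter> V \<xi>)"
    "local_defining_fn L (\<Phi> \<xi> ` (frontier \<Omega> \<inter> V \<xi>)) y r U" "line_type r y = enat L"
    using assms unfolding finite_local_line_type_def by (elim conjE exE bexE) (rule that)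
  from line_type_ge_1[OF *(2,1)] *(3) have "enat 1 \<le> enat L" by (simp add: one_enat_def)
  thus ?thesis by simp
qed

lemma cholo_on_continuous: "cholo_on f S \<Longrightarrow> continuous_on S f"
  unfolding cholo_on_def
  by (meson continuous_at_imp_continuous_on has_derivative_continuous)

text \<open>Compactness of the frontier: finitely many balls of radius \<open>\<tau> / 2\<close>
  cover it, and an interior ball chosen for a centre \<open>\<zeta>\<close> serves every
  \<open>\<xi>\<close> within \<open>\<tau> / 2\<close> of \<open>\<zeta>\<close>.\<close>

lemma frontier_uniform_interior_ball:
  fixes \<Omega> :: "'a::euclidean_space set"
  assumes "open \<Omega>" "bounded \<Omega>" "0 < \<tau>"
  shows "\<exists>c>0. \<forall>\<xi>\<in>frontier \<Omega>. \<exists>p. cball p c \<subseteq> \<Omega> \<inter> ball \<xi> \<tau>"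
proof -
  have "\<exists>p c. 0 < c \<and> cball p c \<subseteq> \<Omega> \<inter> ball \<xi> (\<tau>/2)" if "\<xi> \<in> frontier \<Omega>" for \<xi>
  proof -
    have "\<xi> \<in> closure \<Omega>" using that by (simp add: frontier_def)
    then obtain p where p: "p \<in> \<Omega>" "dist p \<xi> < \<tau>/2"
      using assms(3) unfolding closure_approachable by (meson half_gt_zero)
    have "open (\<Omega> \<inter> ball \<xi> (\<tau>/2))" using assms(1) by auto
    moreover have "p \<in> \<Omega> \<inter> ball \<xi> (\<tau>/2)" using p by (simp add: dist_commute)
    ultimately show ?thesis unfolding open_contains_cball by blast
  qed
  then obtain p c where pc: "\<And>\<xi>. \<xi> \<in> frontier \<Omega> \<Longrightarrow> 0 < c \<xi> \<and> cball (p \<xi>) (c \<xi>) \<subseteq> \<Omega> \<inter> ball \<xi> (\<tau>/2)"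
    by metis
  have "compact (frontier \<Omega>)" using assms(2) by (rule compact_frontier_bounded)
  moreover have "frontier \<Omega> \<subseteq> (\<Union>\<xi>\<in>frontier \<Omega>. ball \<xi> (\<tau>/2))" using assms(3) by force
  ultimately obtain F where F: "F \<subseteq> frontier \<Omega>" "finite F" "frontier \<Omega> \<subseteq> (\<Union>\<xi>\<in>F. ball \<xi> (\<tau>/2))"
    using compactE_image[of "frontier \<Omega>" "frontier \<Omega>" "\<lambda>\<xi>. ball \<xi> (\<tau>/2)"] open_ball by metis
  \<comment> \<open>The inserted 1 keeps the minimum meaningful when \<open>F\<close> is
    empty.\<close>
  define c0 where "c0 = Min (insert 1 (c ` F))"
  have c0: "0 < c0" "\<And>\<xi>. \<xi> \<in> F \<Longrightarrow> c0 \<le> c \<xi>" using F pc by (auto simp: c0_def)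
  have "\<exists>p. cball p c0 \<subseteq> \<Omega> \<inter> ball \<xi> \<tau>" if \<xi>: "\<xi> \<in> frontier \<Omega>" for \<xi>
  proof -
    obtain \<zeta> where z: "\<zeta> \<in> F" "dist \<zeta> \<xi> < \<tau>/2" using subsetD[OF F(3) \<xi>] by auto
    have "cball (p \<zeta>) c0 \<subseteq> cball (p \<zeta>) (c \<zeta>)" using c0(2)[OF z(1)] by auto
    also have "\<dots> \<subseteq> \<Omega> \<inter> ball \<zeta> (\<tau>/2)" using pc z(1) F(1) by blast
    also have "ball \<zeta> (\<tau>/2) \<subseteq> ball \<xi> \<tau>"
    proof
      fix w assume "w \<in> ball \<zeta> (\<tau>/2)"
      thus "w \<in> ball \<xi> \<tau>" using z(2) dist_triangle[of \<xi> w \<zeta>] by (simp add: dist_commute)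
    qed
    finally show ?thesis by blast
  qed
  thus ?thesis using c0(1) by blast
qed

text \<open>Points of the bounding sphere are sent at distance at least \<open>c / C\<close> from
  \<open>f p\<close>. On the connected target ball the open image of \<open>ball p c\<close> and the
  open complement of the image of \<open>cball p c\<close> are therefore complementary, and the
  former contains \<open>f p\<close>.\<close>

lemma expanding_image_contains_ball:
  fixes f :: "'a::euclidean_space \<Rightarrow> 'b::real_normed_vector"
  assumes cont: "continuous_on (cball p c) f" and op: "open (f ` ball p c)" and c: "0 < c" and C: "0 < C"
    and low: "\<And>x y. x \<in> cball p c \<Longrightarrow> y \<in> cball p c \<Longrightarrow> norm (x - y) \<le> C * norm (f x - f y)"
  shows "ball (f p) (c / C) \<subseteq> f ` ball p c"
proof -
  let ?S = "ball (f p) (c / C)"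
  have cl: "open (- f ` cball p c)"
    using compact_continuous_image[OF cont] by (simp add: compact_imp_closed open_Compl)
  have sub: "?S \<inter> f ` cball p c \<subseteq> f ` ball p c"
  proof
    fix w assume "w \<in> ?S \<inter> f ` cball p c"
    then obtain x where x: "x \<in> cball p c" "w = f x" "norm (f p - f x) < c / C" by (auto simp: dist_norm)
    have "norm (p - x) \<le> C * norm (f p - f x)" using low[of p x] x c by auto
    also have "\<dots> < c" using x(3) C by (simp add: field_simps)
    finally show "w \<in> f ` ball p c" using x(2) by (auto simp: dist_norm)
  qed
  have "f ` ball p c \<inter> ?S = {} \<or> - f ` cball p c \<inter> ?S = {}"
    by (rule connectedD[OF connected_ball op cl]) (use sub in auto)
  moreover have "f p \<in> f ` ball p c \<inter> ?S" using c C by auto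
  ultimately show ?thesis using sub by blast
qed

section \<open>The localization theorem\<close>

theorem theorem16p3:
  fixes \<Omega> :: "(complex^'n) set" and L :: nat
    and V :: "complex^'n \<Rightarrow> (complex^'n) set"
    and \<Phi> :: "complex^'n \<Rightarrow> complex^'n \<Rightarrow> complex^'n"
  assumes "open \<Omega>" and "bounded \<Omega>"
    and "locally_convexifiable \<Omega>"
    and "finite_local_line_type \<Omega> L"
    and "good_atlas \<Omega> L V \<Phi>"
  shows "\<exists>K \<delta>. K > 0 \<and> \<delta> > 0 \<and>
           (\<forall>\<xi>\<in>frontier \<Omega>. \<forall>p\<in>ball \<xi> \<delta> \<inter> \<Omega>. \<forall>q\<in>ball \<xi> \<delta> \<inter> \<Omega>.
              kobayashi_dist \<Omega> p q \<le> kobayashi_dist (\<Omega> \<inter> V \<xi>) p q \<and>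
              kobayashi_dist (\<Omega> \<inter> V \<xi>) p q \<le> kobayashi_dist \<Omega> p q + ereal K)"
proof -
  have L: "0 < L" by (rule finite_local_line_type_pos[OF assms(4)])
  have chart: "local_convex_chart \<Omega> \<xi> (V \<xi>) (\<Phi> \<xi>)" if "\<xi> \<in> frontier \<Omega>" for \<xi>
    using assms(5) that unfolding good_atlas_def locally_convex_atlas_def by blast
  from assms(5) obtain C \<tau> where C: "0 < C" and \<tau>: "0 < \<tau>"
    and good: "\<forall>\<xi>\<in>frontier \<Omega>. ball \<xi> \<tau> \<subseteq> V \<xi> \<and>
        (\<forall>p\<in>\<Phi> \<xi> ` (V \<xi> \<inter> \<Omega>). \<forall>v. v \<noteq> 0 \<longrightarrow>
            bdist_dir (\<Phi> \<xi> ` (V \<xi> \<inter> \<Omega>)) p v \<le> C * bdist (\<Phi> \<xi> ` (V \<xi> \<inter> \<Omega>)) p powr (1 / real L)) \<and>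
        (\<forall>p\<in>V \<xi>. \<forall>q\<in>V \<xi>. norm (p - q) / C \<le> norm (\<Phi> \<xi> p - \<Phi> \<xi> q) \<and>
                           norm (\<Phi> \<xi> p - \<Phi> \<xi> q) \<le> C * norm (p - q))"
    unfolding good_atlas_def by (elim exE conjE) (rule that)
  note ball = bspec[OF good, THEN conjunct1]
  note dir = bspec[OF good, THEN conjunct2, THEN conjunct1, rule_format]
  note lip = bspec[OF good, THEN conjunct2, THEN conjunct2, rule_format]
  note low = lip[THEN conjunct1] and upp = lip[THEN conjunct2]
  have low': "norm (x - y) \<le> C * norm (\<Phi> \<xi> x - \<Phi> \<xi> y)" if "\<xi> \<in> frontier \<Omega>" "x \<in> V \<xi>" "y \<in> V \<xi>" for \<xi> x y
    using low[OF that] C by (simp add: divide_le_eq mult.commute)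
  have "\<forall>\<xi>\<in>frontier \<Omega>. \<exists>\<Psi>. cholo_on \<Psi> (\<Phi> \<xi> ` V \<xi>) \<and> (\<forall>x\<in>V \<xi>. \<Psi> (\<Phi> \<xi> x) = x)"
    using chart unfolding local_convex_chart_def by blast
  from bchoice[OF this] obtain \<Psi> where \<Psi>:
    "\<And>\<xi>. \<xi> \<in> frontier \<Omega> \<Longrightarrow> cholo_on (\<Psi> \<xi>) (\<Phi> \<xi> ` V \<xi>) \<and> (\<forall>x\<in>V \<xi>. \<Psi> \<xi> (\<Phi> \<xi> x) = x)"
    by blast
  \<comment> \<open>The image of \<open>V \<xi> \<inter> W\<close> is the preimage of
    \<open>W\<close> under the continuous inverse chart, hence open.\<close>
  have open_image: "open (\<Phi> \<xi> ` (V \<xi> \<inter> W))" if \<xi>: "\<xi> \<in> frontier \<Omega>" and W: "open W" for \<xi> W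
  proof -
    have "open (\<Phi> \<xi> ` V \<xi> \<inter> \<Psi> \<xi> -` W)"
      using chart[OF \<xi>] \<Psi>[OF \<xi>] W unfolding local_convex_chart_def
      by (intro continuous_open_preimage cholo_on_continuous) auto
    moreover have "\<Phi> \<xi> ` V \<xi> \<inter> \<Psi> \<xi> -` W = \<Phi> \<xi> ` (V \<xi> \<inter> W)" using \<Psi>[OF \<xi>] by auto
    ultimately show ?thesis by simp
  qed
  obtain c where c: "0 < c" and cb: "\<And>\<xi>. \<xi> \<in> frontier \<Omega> \<Longrightarrow> \<exists>p. cball p c \<subseteq> \<Omega> \<inter> ball \<xi> \<tau>"
    using frontier_uniform_interior_ball[OF assms(1,2) \<tau>] by blast
  have inner: "\<exists>p. ball p (c / C) \<subseteq> \<Phi> \<xi> ` (V \<xi> \<inter> \<Omega>)" if \<xi>: "\<xi> \<in> frontier \<Omega>" for \<xi>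
  proof -
    obtain p where p: "cball p c \<subseteq> \<Omega> \<inter> V \<xi>" using cb[OF \<xi>] ball[OF \<xi>] by blast
    have pV: "x \<in> V \<xi>" if "x \<in> cball p c" for x using p that by blast
    have "ball p c \<subseteq> V \<xi>" using p ball_subset_cball by blast
    hence "open (\<Phi> \<xi> ` ball p c)" using open_image[OF \<xi>, of "ball p c"] by (simp add: inf_absorb2)
    moreover have "continuous_on (cball p c) (\<Phi> \<xi>)"
      using chart[OF \<xi>] pV unfolding local_convex_chart_def
      by (meson cholo_on_continuous continuous_on_subset subsetI)
    ultimately have "ball (\<Phi> \<xi> p) (c / C) \<subseteq> \<Phi> \<xi> ` ball p c"
      by (intro expanding_image_contains_ball c C low'[OF \<xi>] pV) auto
    also have "\<dots> \<subseteq> \<Phi> \<xi> ` (V \<xi> \<inter> \<Omega>)" using p ball_subset_cball by blast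
    finally show ?thesis by blast
  qed
  obtain B where B: "\<And>x. x \<in> \<Omega> \<Longrightarrow> norm x \<le> B" using assms(2) by (auto simp: bounded_iff)
  \<comment> \<open>The added 1 makes the diameter bound strict and \<open>M\<close>
    positive.\<close>
  define M where "M = 2 * \<bar>B\<bar> + 1"
  have M: "dist x y < M" if "x \<in> \<Omega>" "y \<in> \<Omega>" for x y
    using B[OF that(1)] B[OF that(2)] norm_triangle_ineq4[of x y] by (simp add: M_def dist_norm)
  interpret uniform_atlas \<Omega> "frontier \<Omega>" V \<Phi> \<Psi> C \<tau> M "1 / real L" "c / C"
  proof
    show "0 < M" by (simp add: M_def)
    show "open (\<Phi> \<xi> ` (V \<xi> \<inter> \<Omega>))" if "\<xi> \<in> frontier \<Omega>" for \<xi> by (rule open_image[OF that assms(1)])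
    show "cholo_on (\<Phi> \<xi>) (V \<xi>)" "convex (\<Phi> \<xi> ` (V \<xi> \<inter> \<Omega>))" if "\<xi> \<in> frontier \<Omega>" for \<xi>
      using chart[OF that] by (simp_all add: local_convex_chart_def)
    show "0 < c / C" "0 < 1 / real L" using c C L by simp_all
    show "\<Psi> \<xi> (\<Phi> \<xi> x) = x" if "\<xi> \<in> frontier \<Omega>" "x \<in> V \<xi>" for \<xi> x using \<Psi> that by blast
    show "cholo_on (\<Psi> \<xi>) (\<Phi> \<xi> ` V \<xi>)" if "\<xi> \<in> frontier \<Omega>" for \<xi> using \<Psi> that by blast
  qed (fact C \<tau> M ball inner dir low' upp)+
  obtain K where K: "0 < K" and up: "\<forall>\<xi>\<in>frontier \<Omega>. \<forall>p\<in>ball \<xi> (\<tau>/8) \<inter> \<Omega>. \<forall>q\<in>ball \<xi> (\<tau>/8) \<inter> \<Omega>.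
     kobayashi_dist (\<Omega> \<inter> V \<xi>) p q \<le> kobayashi_dist \<Omega> p q + ereal K"
    using kobayashi_localization by (elim exE conjE) (rule that)
  show ?thesis
  proof (intro exI conjI ballI)
    show "0 < K" "0 < \<tau> / 8" using K \<tau> by simp_all
    fix \<xi> p q assume *: "\<xi> \<in> frontier \<Omega>" "p \<in> ball \<xi> (\<tau>/8) \<inter> \<Omega>" "q \<in> ball \<xi> (\<tau>/8) \<inter> \<Omega>"
    show "kobayashi_dist \<Omega> p q \<le> kobayashi_dist (\<Omega> \<inter> V \<xi>) p q" by (rule kobayashi_mono) simp
    show "kobayashi_dist (\<Omega> \<inter> V \<xi>) p q \<le> kobayashi_dist \<Omega> p q + ereal K" by (rule up[rule_format, OF *])
  qed
qed

end
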